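(* Let $(\xi_y)_{y\in\mathbb{N}^2}$ be i.i.d. random variables with $P(\xi_y=k)=(1-\lambda)\lambda^k$ for $k=0,1,2,\dots$, where $\lambda\in(0,1)$, and fix $\beta>0$. For $N,M\in\mathbb{N}$ let $$G(N,M)=\max\sum_{j=1}^{N+M-1}\xi_{y_j},$$ the maximum being over all paths $(y_1,\dots,y_{N+M-1})$ in $\{1,\dots,N\}\times\{1,\dots,M\}$ with $y_1=(1,1)$, $y_{N+M-1}=(N,M)$ and $y_{j+1}-y_j\in\{(1,0),(0,1)\}$. Then almost surely $$\lim_{N\to\infty}\frac1N G(N,\lfloor\beta N\rfloor)=\frac{(1+\sqrt{\beta\lambda})^2}{1-\lambda}-1.$$ Moreover, for each $\delta>0$ there exist constants $C,c>0$ such that for all $N\in\mathbb{N}$ with $\lfloor\beta N\rfloor\ge1$, $$P\Bigl\{\Bigl|\frac1N G(N,\lfloor\beta N\rfloor)-\Bigl(\frac{(1+\sqrt{\beta\lambda})^2}{1-\lambda}-1\Bigr)\Bigr|>\delta\Bigr\}\le Ce^{-cN}.$$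
   Context: $\mathbb{N}=\{1,2,\dots\}$. *)

theory Defs
  imports "HOL-Probability.Probability"
begin

text \<open>Up-right lattice paths from (1,1) to (N,M) in {1..N} x {1..M}, given as lists
  of length N+M-1 (list index 0 corresponds to y_1).\<close>
definition up_right_path :: "nat \<Rightarrow> nat \<Rightarrow> (nat \<times> nat) list \<Rightarrow> bool" where
  "up_right_path N M ys \<longleftrightarrow>
     length ys = N + M - 1 \<and> ys \<noteq> [] \<and>
     set ys \<subseteq> {1..N} \<times> {1..M} \<and>
     hd ys = (1, 1) \<and> last ys = (N, M) \<and>
     (\<forall>j. Suc j < length ys \<longrightarrow>
        ys ! Suc j = (fst (ys ! j) + 1, snd (ys ! j)) \<or>
        ys ! Suc j = (fst (ys ! j), snd (ys ! j) + 1))"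

definition lpp :: "(nat \<times> nat \<Rightarrow> 'a \<Rightarrow> nat) \<Rightarrow> nat \<Rightarrow> nat \<Rightarrow> 'a \<Rightarrow> nat" where
  "lpp \<xi> N M \<omega> = Max {(\<Sum>y\<leftarrow>ys. \<xi> y \<omega>) | ys. up_right_path N M ys}"

end

theory Submission
  imports Defs
begin

text \<open>
  Put independent geometric weights with parameters \<open>a\<close> and \<open>b\<close> on the two axes, where
  \<open>a * b = \<lambda>\<close>. The resulting last-passage time is stationary (Burke's property): its increments along
  any horizontal line are again i.i.d. with parameter \<open>a\<close>. Hence it obeys Chernoff bounds around an
  explicit mean, and it dominates \<open>G\<close>; minimising the mean over \<open>a\<close> gives the upper bound.
  For the lower bound, compare the optimal \<open>a\<close> with slightly larger and smaller ones: an optimal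
  path of the stationary model which followed an axis for a macroscopic distance would make the
  passage time of one of the perturbed models too large. So it leaves the axes near the
  origin, and the stationary passage time exceeds \<open>G\<close> only by a small multiple of \<open>N\<close>.
  Almost sure convergence then follows from the Borel-Cantelli lemma.
\<close>

section \<open>Passage times with boundary weights\<close>

text \<open>Origin of the constants: for the means x = a/(1-a) and y = b/(1-b), the constraint ab =
  \<open>lam\<close> is the hyperbola (x-r)(y-r) = q with r =
  \<open>lam\<close>/(1-\<open>lam\<close>) and q = \<open>lam\<close>/(1-\<open>lam\<close>)^2.
  Setting x = r + \<tau> and y = r + q/\<tau>, the stationary mean per unit of N is r + \<beta> r +
  \<tau> + \<beta> q/\<tau>. It is least at \<tau> = t = sqrt(\<beta>
  \<open>lam\<close>)/(1-\<open>lam\<close>), where \<beta> q = t^2, and its value there, r +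
  \<beta> r + 2t, is the claimed limit. Obstacle: the sums along the left axis and along the top
  line are dependent. Only the marginal law of each is used, and the estimates are joined by union
  bounds, which preserve exponential decay. On the resulting good event the lower bound is
  deterministic: the three stationary models need share nothing but the bulk weights
  \<open>w\<close>, and the comparison holds for each \<open>w\<close> separately. All laws are
  discrete measures on finite grids, so independence becomes commutation of binds; the given
  probability space enters only at the end.\<close>

text \<open>Here \<open>w j i\<close> is the weight at the site \<open>(i + 1, j + 1)\<close>, while \<open>U k\<close> and \<open>V k\<close> are the weights
  at \<open>(k + 1, 0)\<close> and \<open>(0, k + 1)\<close>.\<close>
fun boundary_lpp ::
  "(nat \<Rightarrow> nat) \<Rightarrow> (nat \<Rightarrow> nat) \<Rightarrow> (nat \<Rightarrow> nat \<Rightarrow> nat) \<Rightarrow> nat \<Rightarrow> nat \<Rightarrow> nat" where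
  "boundary_lpp U V w 0 j = (\<Sum>k<j. V k)"
| "boundary_lpp U V w (Suc i) 0 = (\<Sum>k<Suc i. U k)"
| "boundary_lpp U V w (Suc i) (Suc j) =
     w j i + max (boundary_lpp U V w i (Suc j)) (boundary_lpp U V w (Suc i) j)"

text \<open>This is \<open>G\<close> itself: a walk along an axis earns nothing, and entering the
  bulk later than at (1,1) only forgoes nonnegative weights.\<close>

abbreviation "corner_lpp \<equiv> boundary_lpp (\<lambda>_. 0) (\<lambda>_. 0)"

lemma boundary_lpp_0_right [simp]: "boundary_lpp U V w i 0 = (\<Sum>k<i. U k)"
  by (cases i) auto

lemma boundary_lpp_mono:
  assumes "\<And>k. U k \<le> U' k" "\<And>k. V k \<le> V' k"
  shows "boundary_lpp U V w i j \<le> boundary_lpp U' V' w i j"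
  using assms
  by (induction U V w i j rule: boundary_lpp.induct)
     (auto intro!: sum_mono add_mono max.mono simp del: sum.lessThan_Suc simp: max.coboundedI1 max.coboundedI2)

lemma corner_lpp_le_boundary_lpp: "corner_lpp w i j \<le> boundary_lpp U V w i j"
  by (rule boundary_lpp_mono) auto

lemma boundary_lpp_Suc_left: "boundary_lpp U V w i j \<le> boundary_lpp U V w (Suc i) j"
  by (cases j) (auto simp: max_def)

lemma boundary_lpp_Suc_right: "boundary_lpp U V w i j \<le> boundary_lpp U V w i (Suc j)"
  by (cases i) auto

lemma boundary_lpp_cong:
  assumes "\<And>k. k < i \<Longrightarrow> U k = U' k" "\<And>k. k < j \<Longrightarrow> V k = V' k"
    and "\<And>k l. l < i \<Longrightarrow> k < j \<Longrightarrow> w k l = w' k l"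
  shows "boundary_lpp U V w i j = boundary_lpp U' V' w' i j"
  using assms
proof (induction U V w i j rule: boundary_lpp.induct)
  case (3 U V w i j)
  have "boundary_lpp U V w i (Suc j) = boundary_lpp U' V' w' i (Suc j)"
       "boundary_lpp U V w (Suc i) j = boundary_lpp U' V' w' (Suc i) j"
    using "3.prems" by (intro "3.IH"; simp)+
  then show ?case using "3.prems"(3)[of i j] by simp
qed (auto intro!: sum.cong simp del: sum.lessThan_Suc)

text \<open>The index \<open>k\<close> is where an optimal path leaves the boundary: from there on it collects
  the same bulk weights for every choice of the boundary weights.\<close>
lemma boundary_lpp_exit_point:
  assumes "0 < i" "0 < j"
  shows "(\<exists>k\<le>i. \<forall>U' V'. boundary_lpp U V w i j + (\<Sum>l<k. U' l)
             \<le> (\<Sum>l<k. U l) + boundary_lpp U' V' w i j) \<or>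
         (\<exists>k\<le>j. \<forall>U' V'. boundary_lpp U V w i j + (\<Sum>l<k. V' l)
             \<le> (\<Sum>l<k. V l) + boundary_lpp U' V' w i j)"
  using assms
proof (induction "i + j" arbitrary: i j)
  case 0
  then show ?case by simp
next
  case (Suc s)
  then obtain i' j' where ij: "i = Suc i'" "j = Suc j'"
    by (metis gr0_conv_Suc)
  show ?case
  proof (cases "boundary_lpp U V w i' j \<ge> boundary_lpp U V w i j'")
    case le: True
    then have H: "boundary_lpp U V w i j = w j' i' + boundary_lpp U V w i' j"
      by (simp add: ij)
    \<comment> \<open>Equality holds only for the given boundary weights; other weights may prefer
      the other predecessor, so an inequality is all that survives.\<close>
    have H': "boundary_lpp U' V' w i j \<ge> w j' i' + boundary_lpp U' V' w i' j" for U' V'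
      by (simp add: ij)
    show ?thesis
    proof (cases "i' = 0")
      case True
      \<comment> \<open>The predecessor lies on the vertical axis at height \<open>j\<close>, so the
        path has collected all of \<open>V\<close> up to \<open>j\<close>: the exit index is
        \<open>j\<close>.\<close>
      have "boundary_lpp U V w i j + (\<Sum>l<j. V' l) \<le> (\<Sum>l<j. V l) + boundary_lpp U' V' w i j" for U' V'
        using H H'[of U' V'] True by simp
      then show ?thesis by blast
    next
      case False
      with Suc.hyps(1)[of i' j] Suc.hyps(2) Suc.prems ij
      consider (h) k where "k \<le> i'" "\<forall>U' V'. boundary_lpp U V w i' j + (\<Sum>l<k. U' l)
             \<le> (\<Sum>l<k. U l) + boundary_lpp U' V' w i' j"
        | (v) k where "k \<le> j" "\<forall>U' V'. boundary_lpp U V w i' j + (\<Sum>l<k. V' l)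
             \<le> (\<Sum>l<k. V l) + boundary_lpp U' V' w i' j"
        by auto
      then show ?thesis
      proof cases
        case h
        have "boundary_lpp U V w i j + (\<Sum>l<k. U' l) \<le> (\<Sum>l<k. U l) + boundary_lpp U' V' w i j" for U' V'
          using H H'[of U' V'] h(2)[rule_format, of U' V'] by linarith
        then show ?thesis using h(1) ij by (metis le_Suc_eq)
      next
        case v
        have "boundary_lpp U V w i j + (\<Sum>l<k. V' l) \<le> (\<Sum>l<k. V l) + boundary_lpp U' V' w i j" for U' V'
          using H H'[of U' V'] v(2)[rule_format, of V' U'] by linarith
        then show ?thesis using v(1) by blast
      qed
    qed
  next
    case le: False
    then have H: "boundary_lpp U V w i j = w j' i' + boundary_lpp U V w i j'"
      by (simp add: ij)
    have H': "boundary_lpp U' V' w i j \<ge> w j' i' + boundary_lpp U' V' w i j'" for U' V'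
      by (simp add: ij)
    show ?thesis
    proof (cases "j' = 0")
      case True
      have "boundary_lpp U V w i j + (\<Sum>l<i. U' l) \<le> (\<Sum>l<i. U l) + boundary_lpp U' V' w i j" for U' V'
        using H H'[of U' V'] True by simp
      then show ?thesis by blast
    next
      case False
      with Suc.hyps(1)[of i j'] Suc.hyps(2) Suc.prems ij
      consider (h) k where "k \<le> i" "\<forall>U' V'. boundary_lpp U V w i j' + (\<Sum>l<k. U' l)
             \<le> (\<Sum>l<k. U l) + boundary_lpp U' V' w i j'"
        | (v) k where "k \<le> j'" "\<forall>U' V'. boundary_lpp U V w i j' + (\<Sum>l<k. V' l)
             \<le> (\<Sum>l<k. V l) + boundary_lpp U' V' w i j'"
        by auto
      then show ?thesis
      proof cases
        case h
        have "boundary_lpp U V w i j + (\<Sum>l<k. U' l) \<le> (\<Sum>l<k. U l) + boundary_lpp U' V' w i j" for U' V'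
          using H H'[of U' V'] h(2)[rule_format, of U' V'] by linarith
        then show ?thesis using h(1) by blast
      next
        case v
        have "boundary_lpp U V w i j + (\<Sum>l<k. V' l) \<le> (\<Sum>l<k. V l) + boundary_lpp U' V' w i j" for U' V'
          using H H'[of U' V'] v(2)[rule_format, of V' U'] by linarith
        then show ?thesis using v(1) ij by (metis le_Suc_eq)
      qed
    qed
  qed
qed

section \<open>Lattice paths and the recursion\<close>

text \<open>Induction strips the last site, and a prefix ends elsewhere than at (N,M); hence neither
  the endpoint nor an upper bound on the coordinates is fixed here.\<close>

lemma path_weight_le_corner_lpp:
  assumes "ys \<noteq> []" "hd ys = (1, 1)" "set ys \<subseteq> {1..} \<times> {1..}"
    and "\<And>j. Suc j < length ys \<Longrightarrow>
        ys ! Suc j = (fst (ys ! j) + 1, snd (ys ! j)) \<or>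
        ys ! Suc j = (fst (ys ! j), snd (ys ! j) + 1)"
  shows "(\<Sum>y\<leftarrow>ys. f y) \<le> corner_lpp (\<lambda>j i. f (Suc i, Suc j)) (fst (last ys)) (snd (last ys))"
  using assms
proof (induction ys rule: rev_induct)
  case (snoc y ys)
  show ?case
  proof (cases "ys = []")
    case True
    then show ?thesis using snoc.prems by simp
  next
    case False
    let ?G = "corner_lpp (\<lambda>j i. f (Suc i, Suc j))"
    have IH: "(\<Sum>y\<leftarrow>ys. f y) \<le> ?G (fst (last ys)) (snd (last ys))"
    proof (rule snoc.IH)
      show "hd ys = (1, 1)" using snoc.prems(2) False by simp
      show "set ys \<subseteq> {1..} \<times> {1..}" using snoc.prems(3) by simp
      fix j assume j: "Suc j < length ys"
      with snoc.prems(4)[of j]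
      show "ys ! Suc j = (fst (ys ! j) + 1, snd (ys ! j)) \<or>
            ys ! Suc j = (fst (ys ! j), snd (ys ! j) + 1)"
        by (auto simp: nth_append)
    qed (use False in simp)
    obtain a b where ab: "last ys = (a, b)" by fastforce
    have "last ys \<in> set ys" using False by simp
    then have pos: "a \<ge> 1" "b \<ge> 1" using ab snoc.prems(3) by auto
    have step: "y = (a + 1, b) \<or> y = (a, b + 1)"
      using snoc.prems(4)[of "length ys - 1"] False ab
      by (auto simp: nth_append last_conv_nth)
    have "f y + ?G a b \<le> ?G (fst y) (snd y)"
      using step pos by (cases a; cases b; auto)
    then show ?thesis using IH ab by simp
  qed
qed simp

text \<open>The recursion is traced backwards: an optimal path to the better predecessor is extended
  by one site.\<close>

lemma ex_up_right_path_corner_lpp: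
  "\<exists>ys. up_right_path (Suc i) (Suc j) ys \<and>
     (\<Sum>y\<leftarrow>ys. f y) = corner_lpp (\<lambda>j i. f (Suc i, Suc j)) (Suc i) (Suc j)"
proof (induction "i + j" arbitrary: i j)
  case 0
  then show ?case by (auto intro!: exI[of _ "[(1,1)]"] simp: up_right_path_def)
next
  case (Suc s)
  let ?G = "corner_lpp (\<lambda>j i. f (Suc i, Suc j))"
  have extend: "\<exists>ys. up_right_path (Suc i) (Suc j) ys \<and> (\<Sum>y\<leftarrow>ys. f y) = f (Suc i, Suc j) + ?G a b"
    if ys: "up_right_path a b ys" "(\<Sum>y\<leftarrow>ys. f y) = ?G a b"
      and ab: "(Suc i, Suc j) = (a + 1, b) \<or> (Suc i, Suc j) = (a, b + 1)" "a > 0" "b > 0" for a b ys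
  proof -
    have "up_right_path (Suc i) (Suc j) (ys @ [(Suc i, Suc j)])"
      unfolding up_right_path_def
    proof (intro conjI allI impI)
      fix k assume k: "Suc k < length (ys @ [(Suc i, Suc j)])"
      show "(ys @ [(Suc i, Suc j)]) ! Suc k =
            (fst ((ys @ [(Suc i, Suc j)]) ! k) + 1, snd ((ys @ [(Suc i, Suc j)]) ! k)) \<or>
            (ys @ [(Suc i, Suc j)]) ! Suc k =
            (fst ((ys @ [(Suc i, Suc j)]) ! k), snd ((ys @ [(Suc i, Suc j)]) ! k) + 1)"
      proof (cases "Suc k < length ys")
        case True
        then show ?thesis using ys(1) by (auto simp: nth_append up_right_path_def)
      next
        case False
        then have "k = length ys - 1" "ys \<noteq> []" using k ys(1) by (auto simp: up_right_path_def)
        moreover from this have "Suc k = length ys" by (cases ys) auto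
        moreover from calculation have "ys ! k = (a, b)"
          using ys(1) by (auto simp: up_right_path_def last_conv_nth)
        ultimately show ?thesis using ab by (auto simp: nth_append)
      qed
    qed (use ys(1) ab in \<open>auto simp: up_right_path_def\<close>)
    then show ?thesis using ys(2) by (intro exI[of _ "ys @ [(Suc i, Suc j)]"]) simp
  qed
  have G: "?G (Suc i) (Suc j) = f (Suc i, Suc j) + max (?G i (Suc j)) (?G (Suc i) j)"
    "i = 0 \<Longrightarrow> ?G i (Suc j) = 0" "j = 0 \<Longrightarrow> ?G (Suc i) j = 0"
    by simp_all
  consider (l) i' where "i = Suc i'" "?G (Suc i) (Suc j) = f (Suc i, Suc j) + ?G i (Suc j)"
    | (r) j' where "j = Suc j'" "?G (Suc i) (Suc j) = f (Suc i, Suc j) + ?G (Suc i) j"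
  \<comment> \<open>The path must avoid the axes. On the bottom row or left column the axis value is
    0, so the maximum is attained at the predecessor inside the grid, also in case of a tie.\<close>
  proof (cases "j = 0 \<or> i > 0 \<and> ?G i (Suc j) \<ge> ?G (Suc i) j")
    case True
    then have "i > 0" "?G i (Suc j) \<ge> ?G (Suc i) j" using Suc.hyps(2) G(3) by auto
    then show ?thesis using l[of "i - 1"] G(1) by simp
  next
    case False
    then have "j > 0" "?G i (Suc j) \<le> ?G (Suc i) j" using G(2) by auto
    then show ?thesis using r[of "j - 1"] G(1) by simp
  qed
  then show ?case
  proof cases
    case l
    then obtain ys where "up_right_path i (Suc j) ys" "(\<Sum>y\<leftarrow>ys. f y) = ?G i (Suc j)"
      using Suc.hyps(1)[of i' j] Suc.hyps(2) by auto
    then show ?thesis using extend[of i "Suc j" ys] l by auto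
  next
    case r
    then obtain ys where "up_right_path (Suc i) j ys" "(\<Sum>y\<leftarrow>ys. f y) = ?G (Suc i) j"
      using Suc.hyps(1)[of i j'] Suc.hyps(2) by auto
    then show ?thesis using extend[of "Suc i" j ys] r by auto
  qed
qed

lemma finite_up_right_paths: "finite {ys. up_right_path N M ys}"
proof (rule finite_subset)
  show "{ys. up_right_path N M ys} \<subseteq> {ys. set ys \<subseteq> {1..N} \<times> {1..M} \<and> length ys = N + M - 1}"
    by (auto simp: up_right_path_def)
qed (rule finite_lists_length_eq, simp)

lemma lpp_eq_corner_lpp:
  assumes "N > 0" "M > 0"
  shows "lpp \<xi> N M \<omega> = corner_lpp (\<lambda>j i. \<xi> (Suc i, Suc j) \<omega>) N M"
  unfolding lpp_def
proof (rule Max_eqI)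
  show "finite {(\<Sum>y\<leftarrow>ys. \<xi> y \<omega>) |ys. up_right_path N M ys}"
    using finite_up_right_paths[of N M] by (auto simp: setcompr_eq_image)
next
  fix s assume "s \<in> {(\<Sum>y\<leftarrow>ys. \<xi> y \<omega>) |ys. up_right_path N M ys}"
  then obtain ys where ys: "up_right_path N M ys" "s = (\<Sum>y\<leftarrow>ys. \<xi> y \<omega>)" by auto
  have "set ys \<subseteq> {1..} \<times> {1..}" using ys(1) by (fastforce simp: up_right_path_def)
  then show "s \<le> corner_lpp (\<lambda>j i. \<xi> (Suc i, Suc j) \<omega>) N M"
    using path_weight_le_corner_lpp[of ys "\<lambda>y. \<xi> y \<omega>"] ys unfolding up_right_path_def by auto
next
  show "corner_lpp (\<lambda>j i. \<xi> (Suc i, Suc j) \<omega>) N M \<in> {(\<Sum>y\<leftarrow>ys. \<xi> y \<omega>) |ys. up_right_path N M ys}"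
    using ex_up_right_path_corner_lpp[of "N - 1" "M - 1" "\<lambda>y. \<xi> y \<omega>"] assms by (auto intro: sym)
qed

section \<open>Burke's property\<close>

text \<open>Truncated subtraction serves as positive part. A cell with bottom increment u, left
  increment v and weight w has right increment w + (v-u)^+ and top increment w + (u-v)^+. Here
  \<open>X\<close> lists the bottom increments of a row, and the vertical increment \<open>v\<close>
  entering on the left is carried through its cells.\<close>

fun right_increment :: "(nat \<Rightarrow> nat) \<Rightarrow> nat \<Rightarrow> (nat \<Rightarrow> nat) \<Rightarrow> nat \<Rightarrow> nat" where
  "right_increment X v w 0 = v"
| "right_increment X v w (Suc i) = w i + (right_increment X v w i - X i)"

definition top_increment :: "(nat \<Rightarrow> nat) \<Rightarrow> nat \<Rightarrow> (nat \<Rightarrow> nat) \<Rightarrow> nat \<Rightarrow> nat" where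
  "top_increment X v w i = w i + (X i - right_increment X v w i)"

lemma right_increment_cong:
  assumes "\<And>k. k < i \<Longrightarrow> X k = X' k" "\<And>k. k < i \<Longrightarrow> w k = w' k"
  shows "right_increment X v w i = right_increment X' v w' i"
  using assms by (induction i) auto

lemma top_increment_cong:
  assumes "\<And>k. k \<le> i \<Longrightarrow> X k = X' k" "\<And>k. k \<le> i \<Longrightarrow> w k = w' k"
  shows "top_increment X v w i = top_increment X' v w' i"
  using assms right_increment_cong[of i X X' w w' v] by (simp add: top_increment_def)

text \<open>One cell seen from its lower-left value \<open>a\<close>; the hypotheses ensure that no
  difference taken from \<open>a\<close> is truncated.\<close>

lemma max_add_diff:
  fixes a b c w :: nat
  assumes "a \<le> b" "a \<le> c"
  shows "w + max c b - c = w + ((b - a) - (c - a))" "w + max c b - b = w + ((c - a) - (b - a))"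
  using assms by (auto simp: max_def)

lemma boundary_lpp_diff_right:
  "boundary_lpp U V w i (Suc j) - boundary_lpp U V w i j =
     right_increment (\<lambda>i. boundary_lpp U V w (Suc i) j - boundary_lpp U V w i j) (V j) (w j) i"
proof (induction i)
  case (Suc i)
  show ?case
    unfolding boundary_lpp.simps(3) right_increment.simps(2) Suc.IH[symmetric]
    by (rule max_add_diff(2)[OF boundary_lpp_Suc_left boundary_lpp_Suc_right])
qed simp

lemma boundary_lpp_diff_left:
  "boundary_lpp U V w (Suc i) (Suc j) - boundary_lpp U V w i (Suc j) =
     top_increment (\<lambda>i. boundary_lpp U V w (Suc i) j - boundary_lpp U V w i j) (V j) (w j) i"
  unfolding top_increment_def boundary_lpp_diff_right[symmetric] boundary_lpp.simps(3)
  by (rule max_add_diff(1)[OF boundary_lpp_Suc_left boundary_lpp_Suc_right])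

text \<open>The library's \<open>geometric_pmf\<close> takes the success probability as its parameter.\<close>
abbreviation geo :: "real \<Rightarrow> nat pmf" where
  "geo a \<equiv> geometric_pmf (1 - a)"

text \<open>Adjoining min u v makes the cell map an involution, since the two output increments have
  minimum w and difference u - v. It preserves the weight a^u b^v (ab)^w, because the common part
  min u v of u and v contributes exactly a power of ab. This is where the bulk parameter has to be
  ab.\<close>

lemma cell_invariance:
  assumes "0 < a" "a < 1" "0 < b" "b < 1"
  shows "map_pmf (\<lambda>(u, v, w). (w + (u - v), w + (v - u), min u v))
           (pair_pmf (geo a) (pair_pmf (geo b) (geo (a * b)))) =
         pair_pmf (geo a) (pair_pmf (geo b) (geo (a * b)))"
    (is "map_pmf ?T ?P = ?P")
proof (rule pmf_eqI)
  fix x :: "nat \<times> nat \<times> nat"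
  have TT: "?T (?T x) = x" for x
    by (cases x) (auto simp: min_def)
  have inj: "inj ?T" by (rule inj_on_inverseI[where g = ?T]) (rule TT)
  have ab: "a * b < 1" "0 < a * b"
    using assms mult_strict_mono[of a 1 b 1] by auto
  obtain u v w where x: "x = (u, v, w)" by (cases x)
  have "pmf (map_pmf ?T ?P) x = pmf (map_pmf ?T ?P) (?T (?T x))" by (simp only: TT)
  also have "\<dots> = pmf ?P (?T x)" by (rule pmf_map_inj'[OF inj])
  also have "\<dots> = pmf ?P x"
  proof -
    have "a ^ (w + (u - v)) * (b ^ (w + (v - u)) * (a * b) ^ min u v) = a ^ u * (b ^ v * (a * b) ^ w)"
    proof (cases "u \<le> v")
      case True
      then obtain d where "v = u + d" using le_Suc_ex by blast
      then show ?thesis by (simp add: power_add power_mult_distrib)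
    next
      case False
      then obtain d where "u = v + d" using le_Suc_ex nat_le_linear by blast
      then show ?thesis by (simp add: power_add power_mult_distrib)
    qed
    then show ?thesis using assms ab by (simp add: x pmf_pair mult_ac)
  qed
  finally show "pmf (map_pmf ?T ?P) x = pmf ?P x" .
qed

text \<open>The auxiliary third coordinate is integrated out; the continuation \<open>K\<close>
  allows the rewriting of a cell inside a longer chain of draws.\<close>

lemma cell_increments:
  assumes "0 < a" "a < 1" "0 < b" "b < 1"
  shows "bind_pmf (geo a) (\<lambda>u. bind_pmf (geo b) (\<lambda>v. bind_pmf (geo (a * b)) (\<lambda>w.
            K (w + (u - v)) (w + (v - u))))) =
         bind_pmf (geo a) (\<lambda>u. bind_pmf (geo b) (\<lambda>v. K u v))"
proof -
  let ?P = "pair_pmf (geo a) (pair_pmf (geo b) (geo (a * b)))"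
  have "bind_pmf (geo a) (\<lambda>u. bind_pmf (geo b) (\<lambda>v. bind_pmf (geo (a * b)) (\<lambda>w.
            K (w + (u - v)) (w + (v - u))))) =
        bind_pmf (map_pmf (\<lambda>(u, v, w). (w + (u - v), w + (v - u), min u v)) ?P) (\<lambda>(u, v, w). K u v)"
    by (simp add: pair_pmf_def bind_map_pmf bind_assoc_pmf bind_return_pmf case_prod_unfold)
  also have "\<dots> = bind_pmf ?P (\<lambda>(u, v, w). K u v)"
    by (simp only: cell_invariance[OF assms])
  also have "\<dots> = bind_pmf (geo a) (\<lambda>u. bind_pmf (geo b) (\<lambda>v. K u v))"
    by (simp add: pair_pmf_def bind_assoc_pmf bind_return_pmf)
  finally show ?thesis .
qed

abbreviation iid_pmf :: "nat \<Rightarrow> nat pmf \<Rightarrow> (nat \<Rightarrow> nat) pmf" where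
  "iid_pmf n p \<equiv> Pi_pmf {..<n} 0 (\<lambda>_. p)"

lemma Pi_pmf_lessThan_Suc:
  "Pi_pmf {..<Suc n} d p = bind_pmf (p n) (\<lambda>y. bind_pmf (Pi_pmf {..<n} d p) (\<lambda>f. return_pmf (f(n := y))))"
  by (simp add: lessThan_Suc Pi_pmf_insert')

text \<open>Induction on the length of the row, the new cell being the rightmost. That cell needs
  its left input independent of the top increments already produced, so the joint law of the tops
  and the right increment is tracked through an arbitrary \<open>K\<close>.\<close>

lemma row_increments:
  assumes "0 < a" "a < 1" "0 < b" "b < 1"
  shows "bind_pmf (iid_pmf n (geo a)) (\<lambda>X. bind_pmf (geo b) (\<lambda>v. bind_pmf (iid_pmf n (geo (a * b))) (\<lambda>w.
            K (\<lambda>i. if i < n then top_increment X v w i else 0) (right_increment X v w n)))) =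
         bind_pmf (iid_pmf n (geo a)) (\<lambda>X. bind_pmf (geo b) (\<lambda>v. K X v))"
proof (induction n arbitrary: K)
  case 0
  then show ?case by (simp add: bind_return_pmf)
next
  case (Suc n)
  have top: "(\<lambda>i. if i < Suc n then top_increment (X(n := x)) v (w(n := y)) i else 0) =
     (\<lambda>i. if i < n then top_increment X v w i else 0)(n := y + (x - right_increment X v w n))"
    for X x v w y
  proof (rule ext)
    fix i
    have "right_increment (X(n := x)) v (w(n := y)) n = right_increment X v w n"
      by (rule right_increment_cong) auto
    moreover have "i < n \<Longrightarrow> top_increment (X(n := x)) v (w(n := y)) i = top_increment X v w i"
      by (rule top_increment_cong) auto
    ultimately show "(if i < Suc n then top_increment (X(n := x)) v (w(n := y)) i else 0) =
       ((\<lambda>i. if i < n then top_increment X v w i else 0)(n := y + (x - right_increment X v w n))) i"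
      by (auto simp: top_increment_def)
  qed
  have right: "right_increment (X(n := x)) v (w(n := y)) (Suc n) = y + (right_increment X v w n - x)"
    for X x v w y
    using right_increment_cong[of n "X(n := x)" X "w(n := y)" w v] by simp
  let ?A = "iid_pmf n (geo a)" and ?C = "iid_pmf n (geo (a * b))"
  note IH = Suc.IH[of "\<lambda>X v. K (X(n := y + (x - v))) (y + (v - x))" for x y]
  note cell = cell_increments[OF assms, of "\<lambda>x v. K (X(n := x)) v" for X]
  have "bind_pmf (iid_pmf (Suc n) (geo a)) (\<lambda>X. bind_pmf (geo b) (\<lambda>v. bind_pmf (iid_pmf (Suc n) (geo (a * b))) (\<lambda>w.
            K (\<lambda>i. if i < Suc n then top_increment X v w i else 0) (right_increment X v w (Suc n))))) =
     bind_pmf (geo a) (\<lambda>x. bind_pmf ?A (\<lambda>X. bind_pmf (geo b) (\<lambda>v. bind_pmf (geo (a * b)) (\<lambda>y. bind_pmf ?C (\<lambda>w.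
       K ((\<lambda>i. if i < n then top_increment X v w i else 0)(n := y + (x - right_increment X v w n)))
         (y + (right_increment X v w n - x)))))))"
    by (simp only: Pi_pmf_lessThan_Suc bind_assoc_pmf bind_return_pmf top right)
  \<comment> \<open>Independent draws commute: the new column's draws move outwards so that the
    first \<open>n\<close> columns form the pattern of the induction hypothesis. Afterwards they
    move inwards again to form a single cell.\<close>
  also have "\<dots> = bind_pmf (geo a) (\<lambda>x. bind_pmf (geo (a * b)) (\<lambda>y. bind_pmf ?A (\<lambda>X. bind_pmf (geo b) (\<lambda>v. bind_pmf ?C (\<lambda>w.
       K ((\<lambda>i. if i < n then top_increment X v w i else 0)(n := y + (x - right_increment X v w n)))
         (y + (right_increment X v w n - x)))))))"
    by (simp only: bind_commute_pmf[of "geo (a * b)" "geo b"] bind_commute_pmf[of "geo (a * b)" ?A])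
  also have "\<dots> = bind_pmf (geo a) (\<lambda>x. bind_pmf (geo (a * b)) (\<lambda>y. bind_pmf ?A (\<lambda>X. bind_pmf (geo b) (\<lambda>v.
       K (X(n := y + (x - v))) (y + (v - x))))))"
    by (simp only: IH)
  also have "\<dots> = bind_pmf ?A (\<lambda>X. bind_pmf (geo a) (\<lambda>x. bind_pmf (geo b) (\<lambda>v. bind_pmf (geo (a * b)) (\<lambda>y.
       K (X(n := y + (x - v))) (y + (v - x))))))"
    by (simp only: bind_commute_pmf[of "geo (a * b)" ?A] bind_commute_pmf[of "geo a" ?A] bind_commute_pmf[of "geo (a * b)" "geo b"])
  also have "\<dots> = bind_pmf ?A (\<lambda>X. bind_pmf (geo a) (\<lambda>x. bind_pmf (geo b) (\<lambda>v. K (X(n := x)) v)))"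
    by (simp only: cell)
  also have "\<dots> = bind_pmf (iid_pmf (Suc n) (geo a)) (\<lambda>X. bind_pmf (geo b) (\<lambda>v. K X v))"
    by (simp only: Pi_pmf_lessThan_Suc bind_assoc_pmf bind_return_pmf bind_commute_pmf[of "geo a" ?A])
  finally show ?case .
qed

abbreviation grid_pmf :: "nat \<Rightarrow> nat \<Rightarrow> nat pmf \<Rightarrow> (nat \<Rightarrow> nat \<Rightarrow> nat) pmf" where
  "grid_pmf n m p \<equiv> Pi_pmf {..<m} (\<lambda>_. 0) (\<lambda>_. iid_pmf n p)"

text \<open>Rows are stacked: the top increments of one row are the bottom increments of the next,
  which has a fresh left increment and fresh weights. The value 0 beyond \<open>n\<close> matches
  the default value of \<open>iid_pmf\<close>.\<close>

theorem burke_top_increments: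
  assumes "0 < a" "a < 1" "0 < b" "b < 1"
  shows "bind_pmf (iid_pmf n (geo a)) (\<lambda>U. bind_pmf (iid_pmf m (geo b)) (\<lambda>V.
           bind_pmf (grid_pmf n m (geo (a * b))) (\<lambda>w.
             return_pmf (\<lambda>i. if i < n then boundary_lpp U V w (Suc i) m - boundary_lpp U V w i m else 0)))) =
         iid_pmf n (geo a)"
proof (induction m)
  case 0
  have "(\<lambda>i. if i < n then U i else 0) = U" if "U \<in> set_pmf (iid_pmf n (geo a))" for U
    using that set_Pi_pmf_subset[of "{..<n}" 0 "\<lambda>_. geo a"] by (auto simp: fun_eq_iff)
  then show ?case
    by (simp add: bind_return_pmf bind_return_pmf' cong: bind_pmf_cong)
next
  case (Suc m)
  let ?A = "iid_pmf n (geo a)" and ?V = "iid_pmf m (geo b)" and ?W = "grid_pmf n m (geo (a * b))"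
  define D where "D U V w = (\<lambda>i. if i < n then boundary_lpp U V w (Suc i) m - boundary_lpp U V w i m else 0)" for U V w
  have step: "(\<lambda>i. if i < n then boundary_lpp U (V(m := v)) (w(m := r)) (Suc i) (Suc m) - boundary_lpp U (V(m := v)) (w(m := r)) i (Suc m) else 0)
    = (\<lambda>i. if i < n then top_increment (D U V w) v r i else 0)" for U V v w r
  proof (rule ext, rule if_cong[OF refl _ refl])
    fix i assume i: "i < n"
    \<comment> \<open>Passage times up to height \<open>m\<close> do not see the new row, which
      carries index \<open>m\<close>.\<close>
    have "boundary_lpp U (V(m := v)) (w(m := r)) k m = boundary_lpp U V w k m" for k
      by (rule boundary_lpp_cong) auto
    then show "boundary_lpp U (V(m := v)) (w(m := r)) (Suc i) (Suc m) - boundary_lpp U (V(m := v)) (w(m := r)) i (Suc m)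
       = top_increment (D U V w) v r i"
      unfolding boundary_lpp_diff_left using i by (auto intro!: top_increment_cong simp: D_def)
  qed
  have IH: "bind_pmf ?A (\<lambda>U. bind_pmf ?V (\<lambda>V. bind_pmf ?W (\<lambda>w. K (D U V w)))) = bind_pmf ?A K" for K :: "_ \<Rightarrow> (nat \<Rightarrow> nat) pmf"
    using arg_cong[OF Suc.IH, of "\<lambda>p. bind_pmf p K"] by (simp only: bind_assoc_pmf bind_return_pmf D_def)
  have "bind_pmf ?A (\<lambda>U. bind_pmf (iid_pmf (Suc m) (geo b)) (\<lambda>V.
           bind_pmf (grid_pmf n (Suc m) (geo (a * b))) (\<lambda>w.
             return_pmf (\<lambda>i. if i < n then boundary_lpp U V w (Suc i) (Suc m) - boundary_lpp U V w i (Suc m) else 0)))) =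
     bind_pmf ?A (\<lambda>U. bind_pmf (geo b) (\<lambda>v. bind_pmf ?V (\<lambda>V. bind_pmf (iid_pmf n (geo (a * b))) (\<lambda>r. bind_pmf ?W (\<lambda>w.
        return_pmf (\<lambda>i. if i < n then top_increment (D U V w) v r i else 0))))))"
    by (simp only: Pi_pmf_lessThan_Suc bind_assoc_pmf bind_return_pmf step)
  also have "\<dots> = bind_pmf (geo b) (\<lambda>v. bind_pmf (iid_pmf n (geo (a * b))) (\<lambda>r. bind_pmf ?A (\<lambda>U. bind_pmf ?V (\<lambda>V. bind_pmf ?W (\<lambda>w.
        return_pmf (\<lambda>i. if i < n then top_increment (D U V w) v r i else 0))))))"
    by (simp only: bind_commute_pmf[of ?V "iid_pmf n (geo (a * b))"] bind_commute_pmf[of ?A "geo b"]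
        bind_commute_pmf[of ?A "iid_pmf n (geo (a * b))"])
  also have "\<dots> = bind_pmf (geo b) (\<lambda>v. bind_pmf (iid_pmf n (geo (a * b))) (\<lambda>r. bind_pmf ?A (\<lambda>U.
        return_pmf (\<lambda>i. if i < n then top_increment U v r i else 0))))"
    by (simp only: IH[of "\<lambda>X. return_pmf (\<lambda>i. if i < n then top_increment X v r i else 0)" for v r])
  also have "\<dots> = bind_pmf ?A (\<lambda>U. bind_pmf (geo b) (\<lambda>v. bind_pmf (iid_pmf n (geo (a * b))) (\<lambda>r.
        return_pmf (\<lambda>i. if i < n then top_increment U v r i else 0))))"
    by (simp only: bind_commute_pmf[of ?A "geo b"] bind_commute_pmf[of ?A "iid_pmf n (geo (a * b))"])
  also have "\<dots> = ?A"
    by (subst row_increments[OF assms, of n "\<lambda>X v. return_pmf X"]) (simp add: bind_return_pmf')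
  finally show ?case .
qed

section \<open>Chernoff bounds for geometric sums\<close>

lemma nn_integral_geo_exp:
  assumes "0 < a" "a < 1" "a * exp \<theta> < 1"
  shows "(\<integral>\<^sup>+ k. ennreal (exp (\<theta> * real k)) \<partial>geo a) = ennreal ((1 - a) / (1 - a * exp \<theta>))"
proof -
  have "(\<integral>\<^sup>+ k. ennreal (exp (\<theta> * real k)) \<partial>geo a) =
        (\<integral>\<^sup>+ k. ennreal ((1 - a) * (a * exp \<theta>) ^ k) \<partial>count_space UNIV)"
    using assms by (simp add: nn_integral_measure_pmf ennreal_mult' [symmetric] exp_of_nat_mult[symmetric]
        power_mult_distrib mult_ac)
  also have "\<dots> = (\<Sum>k. ennreal ((1 - a) * (a * exp \<theta>) ^ k))"
    by (simp add: nn_integral_count_space_nat)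
  also have "\<dots> = ennreal ((1 - a) * (1 / (1 - a * exp \<theta>)))"
    using assms by (intro suminf_ennreal_eq sums_mult geometric_sums) auto
  finally show ?thesis by simp
qed

text \<open>Exponential Markov inequality. The sign of \<theta> is left open, so the same bound
  covers the upper and the lower tail.\<close>

lemma chernoff_geo_sum:
  assumes "0 < a" "a < 1" "a * exp \<theta> < 1" "k \<le> n"
  shows "measure_pmf.prob (iid_pmf n (geo a)) {f. \<theta> * s \<le> \<theta> * real (\<Sum>l<k. f l)}
           \<le> exp (- (\<theta> * s)) * ((1 - a) / (1 - a * exp \<theta>)) ^ k"
proof -
  let ?P = "iid_pmf n (geo a)" and ?phi = "(1 - a) / (1 - a * exp \<theta>)"
  have E: "(\<integral>\<^sup>+ f. ennreal (exp (\<theta> * real (\<Sum>l<k. f l))) \<partial>?P) = ennreal (?phi ^ k)"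
  proof -
    \<comment> \<open>Coordinates from \<open>k\<close> on get the factor 1, which turns the partial
      sum into a product over all coordinates of the product measure.\<close>
    have "(\<Prod>x<n. if x < k then ennreal (exp (\<theta> * real (f x))) else 1) =
        ennreal (exp (\<theta> * real (\<Sum>l<k. f l)))" for f :: "nat \<Rightarrow> nat"
    proof -
      have "(\<Prod>x<n. if x < k then ennreal (exp (\<theta> * real (f x))) else 1) =
         (\<Prod>x\<in>{..<n} \<inter> {x. x < k}. ennreal (exp (\<theta> * real (f x))))"
        by (simp add: prod.inter_restrict)
      also have "{..<n} \<inter> {x. x < k} = {..<k}" using assms(4) by auto
      finally show ?thesis by (simp add: prod_ennreal exp_sum sum_distrib_left)
    qed
    then have "(\<integral>\<^sup>+ f. ennreal (exp (\<theta> * real (\<Sum>l<k. f l))) \<partial>?P) =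
        (\<integral>\<^sup>+ f. (\<Prod>x<n. (\<lambda>y. if x < k then ennreal (exp (\<theta> * real y)) else 1) (f x)) \<partial>?P)"
      by simp
    also have "\<dots> = (\<Prod>x<n. \<integral>\<^sup>+ y. (if x < k then ennreal (exp (\<theta> * real y)) else 1) \<partial>geo a)"
      by (subst nn_integral_prod_Pi_pmf) auto
    also have "\<dots> = (\<Prod>x<n. if x < k then ennreal ?phi else 1)"
      by (intro prod.cong refl) (auto simp: nn_integral_geo_exp[OF assms(1-3)])
    also have "\<dots> = (\<Prod>x\<in>{..<n} \<inter> {x. x < k}. ennreal ?phi)"
      by (subst prod.inter_restrict) auto
    also have "{..<n} \<inter> {x. x < k} = {..<k}" using assms(4) by auto
    finally show ?thesis using assms by (simp add: ennreal_power)
  qed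
  have "emeasure ?P {f. \<theta> * s \<le> \<theta> * real (\<Sum>l<k. f l)} =
      emeasure ?P {f \<in> space ?P. 1 \<le> ennreal (exp (- (\<theta> * s))) * ennreal (exp (\<theta> * real (\<Sum>l<k. f l)))}"
    by (intro arg_cong2[where f = emeasure] refl)
       (auto simp: ennreal_mult'[symmetric] exp_add[symmetric])
  also have "\<dots> \<le> ennreal (exp (- (\<theta> * s))) * (\<integral>\<^sup>+ f. ennreal (exp (\<theta> * real (\<Sum>l<k. f l))) * indicator (space ?P) f \<partial>?P)"
    by (rule nn_integral_Markov_inequality) auto
  also have "\<dots> = ennreal (exp (- (\<theta> * s)) * ?phi ^ k)"
    using E by (simp add: ennreal_mult')
  finally show ?thesis
    using assms by (simp add: measure_pmf.emeasure_eq_measure)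
qed

text \<open>The logarithm of the moment generating function has slope equal to the mean at 0, so for
  a small tilt the slack \<epsilon> absorbs the higher-order terms. The sign \<sigma> = 1 or -1
  selects the tail.\<close>

lemma ex_geo_exponent:
  fixes a \<epsilon> \<sigma> :: real
  assumes "0 < a" "a < 1" "0 < \<epsilon>" "\<sigma> * \<sigma> = 1"
  shows "\<exists>\<tau>>0. a * exp (\<sigma> * \<tau>) < 1 \<and>
           (1 - a) / (1 - a * exp (\<sigma> * \<tau>)) \<le> exp (\<tau> * (\<sigma> * (a / (1 - a)) + \<epsilon>))"
proof -
  define m where "m = a / (1 - a)"
  have m: "(1 - a) * m = a" using assms by (simp add: m_def)
  \<comment> \<open>The desired inequality with denominators cleared: it follows from h < 0, and h
    vanishes at 0 with slope -(1-a)\<epsilon>.\<close>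
  define h where "h = (\<lambda>\<tau>. (1 - a) * exp (- \<tau> * (\<sigma> * m + \<epsilon>)) - (1 - a * exp (\<sigma> * \<tau>)))"
  have "(h has_real_derivative - ((1 - a) * (\<sigma> * m + \<epsilon>)) + a * \<sigma>) (at 0)"
    unfolding h_def by (auto intro!: derivative_eq_intros simp: algebra_simps)
  moreover have "- ((1 - a) * (\<sigma> * m + \<epsilon>)) + a * \<sigma> = - ((1 - a) * \<epsilon>)"
  proof -
    have "(1 - a) * (\<sigma> * m + \<epsilon>) = \<sigma> * ((1 - a) * m) + (1 - a) * \<epsilon>" by (simp add: algebra_simps)
    then show ?thesis by (simp only: m) simp
  qed
  ultimately have "(h has_real_derivative - ((1 - a) * \<epsilon>)) (at 0)" by simp
  moreover have "- ((1 - a) * \<epsilon>) < 0" using assms by simp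
  ultimately obtain d where d: "d > 0" "\<And>y. 0 < y \<Longrightarrow> y < d \<Longrightarrow> h y < h 0"
    using DERIV_neg_dec_right[of h "- ((1 - a) * \<epsilon>)" 0] by auto
  \<comment> \<open>Staying below \<open>d\<close> makes \<open>h\<close> negative; staying below
    \<open>- ln a\<close> keeps the moment generating function finite when \<sigma> = 1.\<close>
  define \<tau> where "\<tau> = min d (- ln a) / 2"
  have la: "- ln a > 0" using assms by simp
  have \<tau>: "0 < \<tau>" "\<tau> < d" "\<tau> < - ln a" using d(1) la by (auto simp: \<tau>_def min_def)
  have "\<sigma> \<le> 1" using assms(4) abs_square_le_1[of \<sigma>] by (simp add: power2_eq_square abs_le_iff)
  then have "\<sigma> * \<tau> < - ln a" using \<tau> mult_right_mono[of \<sigma> 1 \<tau>] by linarith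
  then have "exp (\<sigma> * \<tau>) < exp (- ln a)" by simp
  then have 1: "a * exp (\<sigma> * \<tau>) < 1" using assms by (simp add: exp_minus field_simps)
  have "h \<tau> < 0" using d(2)[OF \<tau>(1,2)] by (simp add: h_def)
  then have "(1 - a) * exp (- (\<tau> * (\<sigma> * m + \<epsilon>))) < 1 - a * exp (\<sigma> * \<tau>)"
    by (simp add: h_def)
  then have "1 - a < (1 - a * exp (\<sigma> * \<tau>)) * exp (\<tau> * (\<sigma> * m + \<epsilon>))"
    by (simp only: exp_minus divide_inverse[symmetric] pos_divide_less_eq[OF exp_gt_zero])
  then have "(1 - a) / (1 - a * exp (\<sigma> * \<tau>)) \<le> exp (\<tau> * (\<sigma> * m + \<epsilon>))"
    using 1 by (simp add: divide_le_eq mult.commute)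
  with 1 \<tau>(1) show ?thesis unfolding m_def by blast
qed

text \<open>Deviations are measured on the scale \<open>N\<close>, not \<open>k\<close>, so that one
  rate serves all \<open>k\<close> up to \<open>K * N\<close>, including very small ones.\<close>

lemma geo_sum_tail:
  fixes a \<epsilon> \<sigma> K :: real
  assumes "0 < a" "a < 1" "0 < \<epsilon>" "0 < K" "\<sigma> * \<sigma> = 1"
  shows "\<exists>c>0. \<forall>n k (N::nat). k \<le> n \<longrightarrow> real k \<le> K * real N \<longrightarrow>
     measure_pmf.prob (iid_pmf n (geo a))
        {f. \<epsilon> * real N \<le> \<sigma> * (real (\<Sum>l<k. f l) - real k * (a / (1 - a)))} \<le> exp (- c * real N)"
proof -
  let ?m = "a / (1 - a)"
  \<comment> \<open>At most \<open>K * N\<close> summands, each with slack \<epsilon>/(2K), use up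
    half of the allowed deviation \<epsilon> N; the other half gives the decay.\<close>
  define \<epsilon>' where "\<epsilon>' = \<epsilon> / (2 * K)"
  have "\<epsilon>' > 0" using assms by (simp add: \<epsilon>'_def)
  from ex_geo_exponent[OF assms(1,2) this assms(5)] obtain \<tau> where \<tau>: "\<tau> > 0" "a * exp (\<sigma> * \<tau>) < 1"
    "(1 - a) / (1 - a * exp (\<sigma> * \<tau>)) \<le> exp (\<tau> * (\<sigma> * ?m + \<epsilon>'))" by blast
  show ?thesis
  proof (intro exI[of _ "\<tau> * \<epsilon> / 2"] conjI allI impI)
    show "\<tau> * \<epsilon> / 2 > 0" using \<tau> assms by simp
    fix n k N :: nat assume k: "k \<le> n" "real k \<le> K * real N"
    define s where "s = real k * ?m + \<sigma> * (\<epsilon> * real N)"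
    have "{f. \<epsilon> * real N \<le> \<sigma> * (real (\<Sum>l<k. f l) - real k * ?m)} =
          {f. (\<sigma> * \<tau>) * s \<le> (\<sigma> * \<tau>) * real (\<Sum>l<k. f l)}"
    proof (intro Collect_cong)
      fix f :: "nat \<Rightarrow> nat"
      define S where "S = real (\<Sum>l<k. f l)"
      have "(\<sigma> * \<tau>) * s = \<sigma> * \<tau> * (real k * ?m) + (\<sigma> * \<sigma>) * (\<tau> * (\<epsilon> * real N))"
        by (simp add: s_def ring_distribs)
      then have "(\<sigma> * \<tau>) * S - (\<sigma> * \<tau>) * s = \<tau> * (\<sigma> * (S - real k * ?m) - \<epsilon> * real N)"
        using assms(5) by (simp add: algebra_simps)
      then show "(\<epsilon> * real N \<le> \<sigma> * (real (\<Sum>l<k. f l) - real k * ?m)) =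
          ((\<sigma> * \<tau>) * s \<le> (\<sigma> * \<tau>) * real (\<Sum>l<k. f l))"
        unfolding S_def[symmetric] using \<tau>(1)
        by (smt (verit) zero_le_mult_iff)
    qed
    then have "measure_pmf.prob (iid_pmf n (geo a))
        {f. \<epsilon> * real N \<le> \<sigma> * (real (\<Sum>l<k. f l) - real k * ?m)} \<le>
        exp (- ((\<sigma> * \<tau>) * s)) * ((1 - a) / (1 - a * exp (\<sigma> * \<tau>))) ^ k"
      using chernoff_geo_sum[OF assms(1,2) \<tau>(2) k(1), of s] by simp
    also have "\<dots> \<le> exp (- ((\<sigma> * \<tau>) * s)) * exp (\<tau> * (\<sigma> * ?m + \<epsilon>')) ^ k"
      using \<tau> assms by (intro mult_left_mono power_mono divide_nonneg_nonneg) auto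
    also have "\<dots> = exp (- ((\<sigma> * \<tau>) * s) + real k * (\<tau> * (\<sigma> * ?m + \<epsilon>')))"
      by (simp only: exp_add exp_of_nat_mult)
    also have "- ((\<sigma> * \<tau>) * s) + real k * (\<tau> * (\<sigma> * ?m + \<epsilon>')) =
        \<tau> * (real k * \<epsilon>') - (\<sigma> * \<sigma>) * (\<tau> * (\<epsilon> * real N))"
      by (simp add: s_def algebra_simps)
    also have "\<dots> = \<tau> * (real k * \<epsilon>' - \<epsilon> * real N)"
      using assms(5) by (simp add: algebra_simps)
    also have "exp \<dots> \<le> exp (- (\<tau> * \<epsilon> / 2) * real N)"
    proof -
      have "real k * \<epsilon>' \<le> K * real N * \<epsilon>'" using k \<open>\<epsilon>' > 0\<close> by (intro mult_right_mono) auto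
      also have "\<dots> = \<epsilon> * real N / 2" using assms by (simp add: \<epsilon>'_def)
      finally have "real k * \<epsilon>' - \<epsilon> * real N \<le> - (\<epsilon> * real N / 2)" by simp
      then have "\<tau> * (real k * \<epsilon>' - \<epsilon> * real N) \<le> \<tau> * (- (\<epsilon> * real N / 2))"
        using \<tau>(1) by (intro mult_left_mono) auto
      then show ?thesis by simp
    qed
    finally show "measure_pmf.prob (iid_pmf n (geo a))
        {f. \<epsilon> * real N \<le> \<sigma> * (real (\<Sum>l<k. f l) - real k * ?m)} \<le> exp (- (\<tau> * \<epsilon> / 2) * real N)" .
  qed
qed

text \<open>Simultaneous control of all prefixes is needed because the exit point is random. The
  union bound costs a factor linear in N, paid for with half of the rate.\<close>

lemma geo_partial_sums_tail:
  fixes a \<epsilon> K :: real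
  assumes "0 < a" "a < 1" "0 < \<epsilon>" "0 < K"
  shows "\<exists>C>0. \<exists>c>0. \<forall>n (N::nat). real n \<le> K * real N \<longrightarrow>
     measure_pmf.prob (iid_pmf n (geo a))
        {f. \<exists>k\<le>n. \<epsilon> * real N \<le> \<bar>real (\<Sum>l<k. f l) - real k * (a / (1 - a))\<bar>} \<le> C * exp (- c * real N)"
proof -
  let ?m = "a / (1 - a)"
  obtain c1 where c1: "c1 > 0" "\<And>n k N. k \<le> n \<Longrightarrow> real k \<le> K * real N \<Longrightarrow>
     measure_pmf.prob (iid_pmf n (geo a))
        {f. \<epsilon> * real N \<le> 1 * (real (\<Sum>l<k. f l) - real k * ?m)} \<le> exp (- c1 * real N)"
    using geo_sum_tail[OF assms, of 1] by auto
  obtain c2 where c2: "c2 > 0" "\<And>n k N. k \<le> n \<Longrightarrow> real k \<le> K * real N \<Longrightarrow>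
     measure_pmf.prob (iid_pmf n (geo a))
        {f. \<epsilon> * real N \<le> - 1 * (real (\<Sum>l<k. f l) - real k * ?m)} \<le> exp (- c2 * real N)"
    using geo_sum_tail[OF assms, of "-1"] by auto
  define c where "c = min c1 c2"
  have c: "c > 0" using c1 c2 by (simp add: c_def)
  have bound: "measure_pmf.prob (iid_pmf n (geo a))
        {f. \<exists>k\<le>n. \<epsilon> * real N \<le> \<bar>real (\<Sum>l<k. f l) - real k * ?m\<bar>}
      \<le> (2 * K * (2 / c) + 2) * exp (- (c / 2) * real N)" if n: "real n \<le> K * real N" for n N :: nat
  proof -
    let ?P = "measure_pmf.prob (iid_pmf n (geo a))"
    let ?A = "\<lambda>k. {f. \<epsilon> * real N \<le> 1 * (real (\<Sum>l<k. f l) - real k * ?m)}"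
    let ?B = "\<lambda>k. {f. \<epsilon> * real N \<le> - 1 * (real (\<Sum>l<k. f l) - real k * ?m)}"
    have abs_ge: "x \<le> \<bar>y\<bar> \<longleftrightarrow> x \<le> 1 * y \<or> x \<le> - 1 * y" for x y :: real
      by arith
    have "{f. \<exists>k\<le>n. \<epsilon> * real N \<le> \<bar>real (\<Sum>l<k. f l) - real k * ?m\<bar>} = (\<Union>k\<in>{..n}. ?A k \<union> ?B k)"
      by (simp only: abs_ge) blast
    then have "?P {f. \<exists>k\<le>n. \<epsilon> * real N \<le> \<bar>real (\<Sum>l<k. f l) - real k * ?m\<bar>} = ?P (\<Union>k\<in>{..n}. ?A k \<union> ?B k)"
      by simp
    also have "\<dots> \<le> (\<Sum>k\<le>n. ?P (?A k \<union> ?B k))"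
      by (intro measure_pmf.finite_measure_subadditive_finite) auto
    also have "\<dots> \<le> (\<Sum>k\<le>n. 2 * exp (- c * real N))"
    proof (intro sum_mono)
      fix k assume "k \<in> {..n}"
      then have k: "k \<le> n" "real k \<le> K * real N" using n by auto
      have "?P (?A k \<union> ?B k) \<le> ?P (?A k) + ?P (?B k)"
        by (intro measure_Un_le) auto
      also have "\<dots> \<le> exp (- c1 * real N) + exp (- c2 * real N)"
        by (intro add_mono c1 c2 k)
      also have "\<dots> \<le> exp (- c * real N) + exp (- c * real N)"
        by (intro add_mono) (auto simp: c_def intro!: mult_right_mono)
      finally show "?P (?A k \<union> ?B k) \<le> 2 * exp (- c * real N)" by simp
    qed
    also have "\<dots> = 2 * (real n + 1) * exp (- c * real N)" by simp
    also have "\<dots> \<le> 2 * (K * real N + 1) * exp (- c * real N)"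
      using n by (intro mult_right_mono) auto
    \<comment> \<open>Prepares for z \<le> exp z with z = cN/2, which absorbs the linear
      factor.\<close>
    also have "\<dots> = (2 * K * (2 / c) * (c / 2 * real N) + 2) * exp (- c * real N)"
      using c by (simp add: algebra_simps)
    also have "\<dots> \<le> (2 * K * (2 / c) * exp (c / 2 * real N) + 2 * exp (c / 2 * real N)) * exp (- c * real N)"
    proof (intro mult_right_mono add_mono mult_left_mono)
      show "c / 2 * real N \<le> exp (c / 2 * real N)"
        using exp_ge_add_one_self[of "c / 2 * real N"] by linarith
      show "2 \<le> 2 * exp (c / 2 * real N)" using c by simp
    qed (use assms c in auto)
    also have "\<dots> = (2 * K * (2 / c) + 2) * (exp (c / 2 * real N) * exp (- c * real N))"
      by (simp add: algebra_simps)
    also have "exp (c / 2 * real N) * exp (- c * real N) = exp (- (c / 2) * real N)"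
      by (simp add: exp_add[symmetric])
    finally show "?P {f. \<exists>k\<le>n. \<epsilon> * real N \<le> \<bar>real (\<Sum>l<k. f l) - real k * ?m\<bar>}
        \<le> (2 * K * (2 / c) + 2) * exp (- (c / 2) * real N)" .
  qed
  have "0 < 2 * K * (2 / c) + 2" "0 < c / 2"
    using assms c by (auto intro!: add_pos_pos divide_pos_pos)
  with bound show ?thesis by blast
qed

section \<open>Concentration\<close>

text \<open>\<open>x\<close> and \<open>y\<close> are the mean boundary weights. The passage time is
  allowed \<open>2 * e\<close>: one \<open>e\<close> for the left axis and one for the increments
  along the top line.\<close>

definition typical_boundary_lpp ::
  "nat \<Rightarrow> nat \<Rightarrow> real \<Rightarrow> real \<Rightarrow> real \<Rightarrow> (nat \<Rightarrow> nat) \<Rightarrow> (nat \<Rightarrow> nat) \<Rightarrow> (nat \<Rightarrow> nat \<Rightarrow> nat) \<Rightarrow> bool"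
where
  "typical_boundary_lpp n m x y e U V w \<longleftrightarrow>
     \<bar>real (boundary_lpp U V w n m) - (real n * x + real m * y)\<bar> \<le> 2 * e \<and>
     (\<forall>k\<le>n. \<bar>real (\<Sum>l<k. U l) - real k * x\<bar> \<le> e) \<and>
     (\<forall>k\<le>m. \<bar>real (\<Sum>l<k. V l) - real k * y\<bar> \<le> e)"

text \<open>Up the left axis, then along the top line, where Burke's property gives the law of the
  increments.\<close>

lemma boundary_lpp_telescope:
  "boundary_lpp U V w n m =
     (\<Sum>l<m. V l) + (\<Sum>i<n. boundary_lpp U V w (Suc i) m - boundary_lpp U V w i m)"
proof (induction n)
  case (Suc n)
  have "boundary_lpp U V w (Suc n) m =
      boundary_lpp U V w n m + (boundary_lpp U V w (Suc n) m - boundary_lpp U V w n m)"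
    using boundary_lpp_Suc_left[of U V w n m] by simp
  then show ?case unfolding sum.lessThan_Suc using Suc.IH by linarith
qed simp

lemma geo_mean_param:
  fixes x :: real
  assumes "x > 0"
  shows "0 < x / (1 + x)" "x / (1 + x) < 1" "(x / (1 + x)) / (1 - x / (1 + x)) = x"
  using assms by (auto simp: field_simps)

text \<open>Parametrised by the means: x/(1+x) is the geometric parameter with mean x.\<close>

abbreviation boundary_pmf :: "nat \<Rightarrow> nat \<Rightarrow> real \<Rightarrow> real \<Rightarrow> ((nat \<Rightarrow> nat) \<times> (nat \<Rightarrow> nat)) pmf" where
  "boundary_pmf n m x y \<equiv> pair_pmf (iid_pmf n (geo (x / (1 + x)))) (iid_pmf m (geo (y / (1 + y))))"

text \<open>Three bad events suffice: some prefix of \<open>U\<close>, of \<open>V\<close> or of the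
  top increments deviates. Each involves a single i.i.d. sequence, so their dependence is
  harmless.\<close>

lemma stationary_lpp_typical:
  fixes lam x y \<epsilon> K :: real
  assumes "0 < x" "0 < y" "x / (1 + x) * (y / (1 + y)) = lam" "0 < \<epsilon>" "0 < K"
  shows "\<exists>C>0. \<exists>c>0. \<forall>n m (N::nat). real n \<le> K * real N \<longrightarrow> real m \<le> K * real N \<longrightarrow>
     measure_pmf.prob (pair_pmf (boundary_pmf n m x y) (grid_pmf n m (geo lam)))
        {((U, V), w). \<not> typical_boundary_lpp n m x y (\<epsilon> * real N) U V w} \<le> C * exp (- c * real N)"
proof -
  let ?a = "x / (1 + x)" and ?b = "y / (1 + y)"
  note a = geo_mean_param[OF assms(1)] and b = geo_mean_param[OF assms(2)]
  define bad where "bad n z N = {f. \<exists>k\<le>n. \<epsilon> * real N \<le> \<bar>real (\<Sum>l<k. f l) - real k * z\<bar>}"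
    for n :: nat and z :: real and N :: nat
  have not_bad: "\<bar>real (\<Sum>l<k. f l) - real k * z\<bar> < \<epsilon> * real N" if "f \<notin> bad n z N" "k \<le> n"
    for f n z N k
    using that unfolding bad_def mem_Collect_eq by (meson not_le)
  obtain C1 c1 where C1: "C1 > 0" "c1 > 0" "\<And>n N. real n \<le> K * real N \<Longrightarrow>
     measure_pmf.prob (iid_pmf n (geo ?a)) (bad n x N) \<le> C1 * exp (- c1 * real N)"
    using geo_partial_sums_tail[OF a(1,2) assms(4,5)] unfolding a(3) bad_def by blast
  obtain C2 c2 where C2: "C2 > 0" "c2 > 0" "\<And>n N. real n \<le> K * real N \<Longrightarrow>
     measure_pmf.prob (iid_pmf n (geo ?b)) (bad n y N) \<le> C2 * exp (- c2 * real N)"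
    using geo_partial_sums_tail[OF b(1,2) assms(4,5)] unfolding b(3) bad_def by blast
  define c where "c = min c1 c2"
  have bound: "measure_pmf.prob (pair_pmf (boundary_pmf n m x y) (grid_pmf n m (geo lam)))
        {((U, V), w). \<not> typical_boundary_lpp n m x y (\<epsilon> * real N) U V w} \<le> (2 * C1 + C2) * exp (- c * real N)"
    if n: "real n \<le> K * real N" and m: "real m \<le> K * real N" for n m N :: nat
  proof -
    let ?Q = "pair_pmf (boundary_pmf n m x y) (grid_pmf n m (geo lam))"
    let ?P = "measure_pmf.prob ?Q"
    define top where "top = (\<lambda>((U, V), w) i. if i < n then boundary_lpp U V w (Suc i) m - boundary_lpp U V w i m else 0)"
    let ?A = "(\<lambda>((U, V), w). U) -` bad n x N" and ?B = "(\<lambda>((U, V), w). V) -` bad m y N"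
      and ?D = "top -` bad n x N"
    have mapU: "map_pmf (\<lambda>((U, V), w). U) ?Q = iid_pmf n (geo ?a)"
      by (simp add: pair_pmf_def map_bind_pmf bind_assoc_pmf bind_return_pmf bind_return_pmf')
    have mapV: "map_pmf (\<lambda>((U, V), w). V) ?Q = iid_pmf m (geo ?b)"
      by (simp add: pair_pmf_def map_bind_pmf bind_assoc_pmf bind_return_pmf bind_return_pmf')
    have mapT: "map_pmf top ?Q = iid_pmf n (geo ?a)"
      using burke_top_increments[OF a(1,2) b(1,2), of n m] assms(3)
      by (simp add: pair_pmf_def map_bind_pmf bind_assoc_pmf bind_return_pmf top_def)
    have "{((U, V), w). \<not> typical_boundary_lpp n m x y (\<epsilon> * real N) U V w} \<subseteq> (?A \<union> ?B) \<union> ?D"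
    proof (rule subsetI, rule ccontr)
      fix z assume z: "z \<in> {((U, V), w). \<not> typical_boundary_lpp n m x y (\<epsilon> * real N) U V w}"
        and nz: "z \<notin> (?A \<union> ?B) \<union> ?D"
      obtain U V w where zz: "z = ((U, V), w)" by (metis prod.collapse)
      have U: "\<bar>real (\<Sum>l<k. U l) - real k * x\<bar> < \<epsilon> * real N" if "k \<le> n" for k
        using nz that by (intro not_bad) (auto simp: zz)
      have V: "\<bar>real (\<Sum>l<k. V l) - real k * y\<bar> < \<epsilon> * real N" if "k \<le> m" for k
        using nz that by (intro not_bad) (auto simp: zz)
      have "\<bar>real (\<Sum>l<n. top z l) - real n * x\<bar> < \<epsilon> * real N"
        using nz by (intro not_bad) auto
      moreover have "(\<Sum>l<n. top z l) = (\<Sum>i<n. boundary_lpp U V w (Suc i) m - boundary_lpp U V w i m)"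
        by (simp add: top_def zz)
      then have "real (boundary_lpp U V w n m) = real (\<Sum>l<m. V l) + real (\<Sum>l<n. top z l)"
        using boundary_lpp_telescope[of U V w n m] by linarith
      ultimately have "\<bar>real (boundary_lpp U V w n m) - (real n * x + real m * y)\<bar> \<le> 2 * (\<epsilon> * real N)"
        using V[of m] by linarith
      then have "typical_boundary_lpp n m x y (\<epsilon> * real N) U V w"
        unfolding typical_boundary_lpp_def using U V by (auto intro: less_imp_le)
      then show False using z zz by auto
    qed
    then have "?P {((U, V), w). \<not> typical_boundary_lpp n m x y (\<epsilon> * real N) U V w} \<le> ?P ((?A \<union> ?B) \<union> ?D)"
      by (intro measure_pmf.finite_measure_mono) auto
    also have "\<dots> \<le> ?P (?A \<union> ?B) + ?P ?D" by (intro measure_Un_le) auto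
    also have "?P (?A \<union> ?B) \<le> ?P ?A + ?P ?B" by (intro measure_Un_le) auto
    also have "?P ?A = measure_pmf.prob (iid_pmf n (geo ?a)) (bad n x N)"
      using arg_cong[OF mapU, of "\<lambda>p. measure_pmf.prob p (bad n x N)"] by (simp only: measure_map_pmf)
    also have "?P ?B = measure_pmf.prob (iid_pmf m (geo ?b)) (bad m y N)"
      using arg_cong[OF mapV, of "\<lambda>p. measure_pmf.prob p (bad m y N)"] by (simp only: measure_map_pmf)
    also have "?P ?D = measure_pmf.prob (iid_pmf n (geo ?a)) (bad n x N)"
      using arg_cong[OF mapT, of "\<lambda>p. measure_pmf.prob p (bad n x N)"] by (simp only: measure_map_pmf)
    also have "measure_pmf.prob (iid_pmf n (geo ?a)) (bad n x N) + measure_pmf.prob (iid_pmf m (geo ?b)) (bad m y N)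
         + measure_pmf.prob (iid_pmf n (geo ?a)) (bad n x N)
       \<le> C1 * exp (- c1 * real N) + C2 * exp (- c2 * real N) + C1 * exp (- c1 * real N)"
      by (intro add_mono C1(3) C2(3) n m)
    also have "\<dots> \<le> C1 * exp (- c * real N) + C2 * exp (- c * real N) + C1 * exp (- c * real N)"
      using C1 C2 by (intro add_mono mult_left_mono) (auto simp: c_def intro!: mult_right_mono)
    finally show ?thesis by (simp add: algebra_simps)
  qed
  have "2 * C1 + C2 > 0" "c > 0" using C1 C2 by (auto simp: c_def)
  with bound show ?thesis by blast
qed

text \<open>Perturbing the stationary density by a factor \<open>1 + \<kappa>\<close> changes the mean of the stationary
  passage time only to order \<open>\<kappa>\<^sup>2\<close>, but the boundary mean to order \<open>\<kappa>\<close>; hence the exit point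
  of the unperturbed system is at distance \<open>O(\<kappa> N)\<close> from the corner.\<close>
lemma typical_imp_corner_lpp_close:
  fixes r q t \<beta> \<kappa> \<delta> x y \<gamma> :: real and N m :: nat
  assumes "0 < r" "0 < q" "0 < t" "0 < \<beta>" "0 < \<kappa>" "\<kappa> \<le> 1" "0 < \<delta>"
    and tt: "\<beta> * q = t * t"
    and x: "x = r + t" and y: "y = r + q / t" and \<gamma>: "\<gamma> = x + \<beta> * y"
    and \<kappa>: "20 * \<gamma> * \<kappa> \<le> \<delta>"
    and N: "y * (1 + \<gamma> / (\<kappa> * t)) \<le> \<delta> / 2 * real N" "0 < N" "0 < m"
    and m: "real m \<le> \<beta> * real N" "\<beta> * real N \<le> real m + 1"
    and T0: "typical_boundary_lpp N m x y (t * \<kappa>\<^sup>2 * real N) U V w"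
    and T1: "typical_boundary_lpp N m (r + t * (1 + \<kappa>)) (r + q / (t * (1 + \<kappa>))) (t * \<kappa>\<^sup>2 * real N) U1 V1 w"
    and T2: "typical_boundary_lpp N m (r + t / (1 + \<kappa>)) (r + q / (t / (1 + \<kappa>))) (t * \<kappa>\<^sup>2 * real N) U2 V2 w"
  shows "\<bar>real (corner_lpp w N m) - \<gamma> * real N\<bar> \<le> \<delta> * real N"
proof -
  define e where "e = t * \<kappa>\<^sup>2 * real N"
  define G where "G = real (corner_lpp w N m)"
  define H where "H = real (boundary_lpp U V w N m)"
  have yx: "0 < x" "0 < y" "0 < \<gamma>" using assms by (auto simp: add_pos_pos)
  have bqt: "\<beta> * (q / t) = t" using tt \<open>0 < t\<close> by simp
  have t\<gamma>: "t \<le> \<gamma>" "x \<le> \<gamma>" "\<beta> * y \<le> \<gamma>"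
    using yx \<open>0 < \<beta>\<close> \<open>0 < r\<close> by (auto simp: \<gamma> x)
  have \<kappa>2: "\<kappa>\<^sup>2 \<le> \<kappa>" using assms by (simp add: power2_eq_square mult_le_cancel_right1)
  have e: "e \<le> \<gamma> * \<kappa> * real N"
    unfolding e_def using t\<gamma> \<kappa>2 assms by (intro mult_right_mono mult_mono) auto
  have \<delta>: "20 * (\<gamma> * \<kappa> * real N) \<le> \<delta> * real N"
    using mult_right_mono[OF \<kappa>, of "real N"] by (simp add: mult_ac)
  have my: "real m * y \<le> \<beta> * y * real N" "\<beta> * y * real N \<le> real m * y + y"
    using mult_right_mono[OF m(1), of y] mult_right_mono[OF m(2), of y] yx by (auto simp: algebra_simps)
  \<comment> \<open>The additional \<open>y\<close> on the lower side pays for replacing \<beta> N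
    by its floor \<open>m\<close>.\<close>
  have H: "H \<le> \<gamma> * real N + 2 * e" "\<gamma> * real N - y - 2 * e \<le> H"
    using T0 my unfolding typical_boundary_lpp_def H_def[symmetric] e_def[symmetric] \<gamma>
    by (auto simp: algebra_simps abs_le_iff)
  have GH: "G \<le> H" unfolding G_def H_def using corner_lpp_le_boundary_lpp[of w N m U V] by simp
  have upper: "G \<le> \<gamma> * real N + \<delta> * real N"
    using GH H(1) e \<delta> yx assms by (smt (verit) mult_nonneg_nonneg of_nat_0_le_iff)
  have f: "t * (1 + \<kappa>) + t / (1 + \<kappa>) \<le> 2 * t + t * \<kappa>\<^sup>2"
  proof -
    have "t / (1 + \<kappa>) \<le> t * (1 - \<kappa> + \<kappa>\<^sup>2)"
    proof -
      have "(1 - \<kappa> + \<kappa>\<^sup>2) * (1 + \<kappa>) = 1 + \<kappa> ^ 3"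
        by (simp add: algebra_simps power2_eq_square power3_eq_cube)
      moreover have "0 < \<kappa> ^ 3" using \<open>0 < \<kappa>\<close> by simp
      ultimately have "t * 1 \<le> t * ((1 - \<kappa> + \<kappa>\<^sup>2) * (1 + \<kappa>))"
        using \<open>0 < t\<close> by (intro mult_left_mono) auto
      then show ?thesis using \<open>0 < \<kappa>\<close> by (simp add: pos_divide_le_eq mult.assoc)
    qed
    then show ?thesis by (simp add: algebra_simps)
  qed
  \<comment> \<open>Common end of both cases, with \<open>p\<close> the mean boundary weight on the
    axis followed. Dividing by \<kappa> t turns 7e into 7\<gamma>\<kappa>N, since e = t\<kappa>^2 N;
    with 3e \<le> 3\<gamma>\<kappa>N the total is 10\<gamma>\<kappa>N, at most half of \<delta>N by
    the factor 20 in the hypothesis. The terms in \<open>y\<close> take the other half, by the lower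
    bound on N.\<close>
  have exit_bound: "\<gamma> * real N - \<delta> * real N \<le> G"
    if k: "real k * p * (\<kappa> * t) \<le> \<gamma> * (7 * e + y)" and GG: "\<gamma> * real N - y - 3 * e - real k * p \<le> G"
    for k :: nat and p :: real
  proof -
    have gen: "10 * A + Z \<le> D" if "20 * A \<le> D" "Z \<le> D / 2" for A Z D :: real
      using that by linarith
    have "real k * p \<le> \<gamma> * (7 * e + y) / (\<kappa> * t)"
      using k assms by (simp add: pos_le_divide_eq)
    also have "\<dots> = 7 * (\<gamma> * \<kappa> * real N) + y * (\<gamma> / (\<kappa> * t))"
      using assms by (simp add: e_def field_simps power2_eq_square)
    finally have "y + 3 * e + real k * p \<le> 10 * (\<gamma> * \<kappa> * real N) + y * (1 + \<gamma> / (\<kappa> * t))"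
      using e by (simp add: algebra_simps)
    also have "\<dots> \<le> \<delta> * real N" by (rule gen[of "\<gamma> * \<kappa> * real N" "\<delta> * real N"]) (use \<delta> N(1) in simp_all)
    finally show ?thesis using GG by linarith
  qed
  from boundary_lpp_exit_point[OF N(2,3), of U V w] have "\<gamma> * real N - \<delta> * real N \<le> G"
  proof (elim disjE exE conjE)
    \<comment> \<open>Exit from the horizontal axis is tested against the model with heavier
      horizontal weights: following the axis for \<open>k\<close> steps there gains k t \<kappa>, up
      to fluctuations, while its passage time grows only by order \<kappa>^2 N.\<close>
    fix k assume k: "k \<le> N" and *: "\<forall>U' V'. boundary_lpp U V w N m + (\<Sum>l<k. U' l)
        \<le> (\<Sum>l<k. U l) + boundary_lpp U' V' w N m"
    define S where "S = real (\<Sum>l<k. U l)"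
    define S1 where "S1 = real (\<Sum>l<k. U1 l)"
    define H1 where "H1 = real (boundary_lpp U1 V1 w N m)"
    have 1: "H \<le> S + G" "H + S1 \<le> S + H1"
      using *[rule_format, of "\<lambda>_. 0" "\<lambda>_. 0"] *[rule_format, of U1 V1]
      unfolding H_def G_def S_def S1_def H1_def by linarith+
    have S: "S \<le> real k * x + e"
      using T0 k unfolding typical_boundary_lpp_def S_def e_def by (auto simp: abs_le_iff)
    have S1: "real k * (r + t * (1 + \<kappa>)) - e \<le> S1"
      using T1 k unfolding typical_boundary_lpp_def S1_def e_def by (force simp: abs_le_iff)
    have "H1 \<le> real N * (r + t * (1 + \<kappa>)) + real m * (r + q / (t * (1 + \<kappa>))) + 2 * e"
      using T1 unfolding typical_boundary_lpp_def H1_def e_def by (auto simp: abs_le_iff)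
    also have "real m * (r + q / (t * (1 + \<kappa>))) \<le> \<beta> * real N * (r + q / (t * (1 + \<kappa>)))"
      using m(1) assms by (intro mult_right_mono) auto
    also have "\<beta> * real N * (r + q / (t * (1 + \<kappa>))) = real N * (\<beta> * r + (\<beta> * (q / t)) / (1 + \<kappa>))"
      by (simp add: algebra_simps)
    also have "\<dots> = real N * (\<beta> * r + t / (1 + \<kappa>))" by (simp only: bqt)
    finally have "H1 \<le> real N * (r + \<beta> * r + (t * (1 + \<kappa>) + t / (1 + \<kappa>))) + 2 * e"
      by (simp add: algebra_simps)
    also have "\<dots> \<le> real N * (r + \<beta> * r + (2 * t + t * \<kappa>\<^sup>2)) + 2 * e"
      by (intro add_right_mono mult_left_mono add_left_mono f) auto
    also have "\<dots> = real N * (r + \<beta> * r + t + \<beta> * (q / t)) + 3 * e"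
      by (simp only: bqt e_def) (simp add: algebra_simps)
    also have "\<dots> = \<gamma> * real N + 3 * e" by (simp add: \<gamma> x y algebra_simps)
    finally have H1: "H1 \<le> \<gamma> * real N + 3 * e" .
    \<comment> \<open>The 7e collects 2e from \<open>H\<close>, e each from \<open>S\<close> and
      \<open>S1\<close>, and 3e from \<open>H1\<close>.\<close>
    have "real k * (t * \<kappa>) \<le> 7 * e + y"
      using 1(2) S S1 H1 H(2) by (simp add: x algebra_simps)
    then have "x * (real k * (t * \<kappa>)) \<le> \<gamma> * (7 * e + y)"
      using t\<gamma> yx assms by (intro mult_mono) auto
    then show ?thesis
      using 1(1) S H(2) by (intro exit_bound[of k x]) (auto simp: mult_ac)
  next
    fix k assume k: "k \<le> m" and *: "\<forall>U' V'. boundary_lpp U V w N m + (\<Sum>l<k. V' l)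
        \<le> (\<Sum>l<k. V l) + boundary_lpp U' V' w N m"
    define S where "S = real (\<Sum>l<k. V l)"
    define S1 where "S1 = real (\<Sum>l<k. V2 l)"
    define H1 where "H1 = real (boundary_lpp U2 V2 w N m)"
    have 1: "H \<le> S + G" "H + S1 \<le> S + H1"
      using *[rule_format, of "\<lambda>_. 0" "\<lambda>_. 0"] *[rule_format, of V2 U2]
      unfolding H_def G_def S_def S1_def H1_def by linarith+
    have S: "S \<le> real k * y + e"
      using T0 k unfolding typical_boundary_lpp_def S_def e_def by (auto simp: abs_le_iff)
    have qt: "q / (t / (1 + \<kappa>)) = q / t * (1 + \<kappa>)" by simp
    have S1: "real k * (r + q / t * (1 + \<kappa>)) - e \<le> S1"
      using T2 k unfolding typical_boundary_lpp_def S1_def e_def qt by (force simp: abs_le_iff)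
    have "H1 \<le> real N * (r + t / (1 + \<kappa>)) + real m * (r + q / t * (1 + \<kappa>)) + 2 * e"
      using T2 unfolding typical_boundary_lpp_def H1_def e_def qt by (auto simp: abs_le_iff)
    also have "real m * (r + q / t * (1 + \<kappa>)) \<le> \<beta> * real N * (r + q / t * (1 + \<kappa>))"
      using m(1) assms by (intro mult_right_mono) auto
    also have "\<beta> * real N * (r + q / t * (1 + \<kappa>)) = real N * (\<beta> * r + (\<beta> * (q / t)) * (1 + \<kappa>))"
      by (simp add: algebra_simps)
    also have "\<dots> = real N * (\<beta> * r + t * (1 + \<kappa>))" by (simp only: bqt)
    finally have "H1 \<le> real N * (r + \<beta> * r + (t * (1 + \<kappa>) + t / (1 + \<kappa>))) + 2 * e"
      by (simp add: algebra_simps)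
    also have "\<dots> \<le> real N * (r + \<beta> * r + (2 * t + t * \<kappa>\<^sup>2)) + 2 * e"
      by (intro add_right_mono mult_left_mono add_left_mono f) auto
    also have "\<dots> = real N * (r + \<beta> * r + t + \<beta> * (q / t)) + 3 * e"
      by (simp only: bqt e_def) (simp add: algebra_simps)
    also have "\<dots> = \<gamma> * real N + 3 * e" by (simp add: \<gamma> x y algebra_simps)
    finally have H1: "H1 \<le> \<gamma> * real N + 3 * e" .
    have "real k * (q / t * \<kappa>) \<le> 7 * e + y"
      using 1(2) S S1 H1 H(2) by (simp add: y algebra_simps add_divide_distrib)
    \<comment> \<open>The vertical gain per step is (q/t)\<kappa>; the factor \<beta> converts q/t
      into t, so that \<open>exit_bound\<close> applies as in the horizontal case.\<close>
    then have "(\<beta> * y) * (real k * (q / t * \<kappa>)) \<le> \<gamma> * (7 * e + y)"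
      using t\<gamma> yx assms by (intro mult_mono) auto
    moreover have "(\<beta> * y) * (real k * (q / t * \<kappa>)) = real k * y * (\<kappa> * (\<beta> * (q / t)))"
      by (simp only: mult_ac)
    ultimately have "real k * y * (\<kappa> * t) \<le> \<gamma> * (7 * e + y)"
      by (simp only: bqt)
    then show ?thesis
      using 1(1) S H(2) by (intro exit_bound[of k y]) auto
  qed
  with upper show ?thesis unfolding G_def by (simp add: abs_le_iff)
qed

text \<open>The parametrisation of the hyperbola (x-r)(y-r) = q by \<tau> = x - r, verified by
  clearing denominators.\<close>

lemma stationary_density:
  fixes lam \<tau> :: real
  assumes "0 < lam" "lam < 1" "0 < \<tau>"
  defines "x \<equiv> lam / (1 - lam) + \<tau>" and "y \<equiv> lam / (1 - lam) + lam / (1 - lam)\<^sup>2 / \<tau>"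
  shows "0 < x" "0 < y" "x / (1 + x) * (y / (1 + y)) = lam"
proof -
  define u where "u = 1 - lam"
  have u: "u > 0" "lam = 1 - u" "u < 1" using assms by (auto simp: u_def)
  have pos: "0 < lam + u * \<tau>" "0 < 1 + u * \<tau>" using assms u(1) by (auto intro!: add_pos_pos)
  show "0 < x" "0 < y" using assms by (auto simp: x_def y_def intro!: add_pos_pos divide_pos_pos)
  have x: "x = (lam + u * \<tau>) / u" "1 + x = (1 + u * \<tau>) / u"
    using u(1) by (auto simp: x_def u_def[symmetric] field_simps) (simp add: u(2))
  have "y = lam / u + lam / u\<^sup>2 / \<tau>" by (simp add: y_def u_def)
  then have y: "y = lam * (1 + u * \<tau>) / (u * u * \<tau>)"
    using u(1) assms(3) by (simp add: field_simps power2_eq_square)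
  have "1 + y = (u * u * \<tau> + lam * (1 + u * \<tau>)) / (u * u * \<tau>)"
    unfolding y using u(1) assms(3) by (simp add: field_simps)
  also have "u * u * \<tau> + lam * (1 + u * \<tau>) = lam + u * \<tau>" unfolding u(2) by (simp add: algebra_simps)
  finally have y1: "1 + y = (lam + u * \<tau>) / (u * u * \<tau>)" .
  have "x / (1 + x) = (lam + u * \<tau>) / (1 + u * \<tau>)" unfolding x(2) unfolding x(1) using u(1) pos by simp
  moreover have "y / (1 + y) = lam * (1 + u * \<tau>) / (lam + u * \<tau>)"
    unfolding y1 unfolding y using u(1) assms(3) pos by simp
  ultimately show "x / (1 + x) * (y / (1 + y)) = lam" using pos by simp
qed

lemma corner_lpp_concentration:
  fixes lam \<beta> \<delta> :: real
  assumes "0 < lam" "lam < 1" "0 < \<beta>" "0 < \<delta>"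
  defines "\<gamma> \<equiv> (1 + sqrt (\<beta> * lam))\<^sup>2 / (1 - lam) - 1"
  shows "\<exists>C>0. \<exists>c>0. \<forall>N m :: nat. 0 < N \<longrightarrow> 0 < m \<longrightarrow> m = nat \<lfloor>\<beta> * real N\<rfloor> \<longrightarrow>
     measure_pmf.prob (grid_pmf N m (geo lam)) {w. \<delta> < \<bar>real (corner_lpp w N m) / real N - \<gamma>\<bar>}
       \<le> C * exp (- c * real N)"
proof -
  define r where "r = lam / (1 - lam)"
  define q where "q = lam / (1 - lam)\<^sup>2"
  define s where "s = sqrt (\<beta> * lam)"
  define t where "t = s / (1 - lam)"
  have pos: "0 < r" "0 < q" "0 < t" "0 < s" using assms by (auto simp: r_def q_def t_def s_def)
  have ss: "s * s = \<beta> * lam" using assms by (simp add: s_def)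
  have tt: "\<beta> * q = t * t" by (simp add: t_def q_def ss power2_eq_square)
  define x where "x = r + t"
  define y where "y = r + q / t"
  have \<gamma>: "\<gamma> = x + \<beta> * y"
  proof -
    have "\<beta> * (q / t) = t" using tt pos by simp
    then have "x + \<beta> * y = r + \<beta> * r + 2 * t" by (simp add: x_def y_def algebra_simps)
    also have "\<dots> = (lam + \<beta> * lam + 2 * s) / (1 - lam)"
      by (simp add: r_def t_def add_divide_distrib)
    also have "\<dots> = \<gamma>"
      using assms(2) ss by (simp add: \<gamma>_def s_def[symmetric] field_simps power2_eq_square)
    finally show ?thesis by simp
  qed
  have \<gamma>0: "0 < \<gamma>" using pos assms unfolding \<gamma> x_def y_def by (intro add_pos_pos mult_pos_pos) auto
  \<comment> \<open>Small enough for the factor 20 of the exit-point estimate; the cap 1 gives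
    \<kappa>^2 \<le> \<kappa> there.\<close>
  define \<kappa> where "\<kappa> = min 1 (\<delta> / (20 * \<gamma>))"
  have \<kappa>: "0 < \<kappa>" "\<kappa> \<le> 1" using \<gamma>0 assms(4) unfolding \<kappa>_def by (auto intro!: divide_pos_pos)
  have "\<kappa> \<le> \<delta> / (20 * \<gamma>)" by (simp add: \<kappa>_def)
  then have \<kappa>\<delta>: "20 * \<gamma> * \<kappa> \<le> \<delta>" using \<gamma>0 by (simp add: pos_le_divide_eq mult.commute)
  define \<eta> where "\<eta> = t * \<kappa>\<^sup>2"
  have \<eta>: "0 < \<eta>" using pos \<kappa> by (simp add: \<eta>_def)
  define K where "K = max 1 \<beta>"
  have K: "0 < K" by (simp add: K_def)
  define X where "X \<tau> = r + \<tau>" for \<tau> :: real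
  define Y where "Y \<tau> = r + q / \<tau>" for \<tau> :: real
  have typical: "\<exists>C>0. \<exists>c>0. \<forall>n m (N::nat). real n \<le> K * real N \<longrightarrow> real m \<le> K * real N \<longrightarrow>
     measure_pmf.prob (pair_pmf (boundary_pmf n m (X \<tau>) (Y \<tau>)) (grid_pmf n m (geo lam)))
        {((U, V), w). \<not> typical_boundary_lpp n m (X \<tau>) (Y \<tau>) (\<eta> * real N) U V w} \<le> C * exp (- c * real N)"
    if "\<tau> > 0" for \<tau>
    using stationary_density[OF assms(1,2) that] \<eta> K unfolding X_def Y_def r_def q_def
    by (intro stationary_lpp_typical) auto
  define t1 where "t1 = t * (1 + \<kappa>)"
  define t2 where "t2 = t / (1 + \<kappa>)"
  have t12: "t1 > 0" "t2 > 0" using pos \<kappa> by (auto simp: t1_def t2_def)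
  define bad where "bad n m N \<tau> = {((U, V), w). \<not> typical_boundary_lpp n m (X \<tau>) (Y \<tau>) (\<eta> * real N) U V w}"
    for n m N :: nat and \<tau>
  obtain C0 c0 where C0: "C0 > 0" "c0 > 0" "\<And>n m N. real n \<le> K * real N \<Longrightarrow> real m \<le> K * real N \<Longrightarrow>
     measure_pmf.prob (pair_pmf (boundary_pmf n m (X t) (Y t)) (grid_pmf n m (geo lam))) (bad n m N t)
       \<le> C0 * exp (- c0 * real N)"
    using typical[OF pos(3)] unfolding bad_def by blast
  obtain C1 c1 where C1: "C1 > 0" "c1 > 0" "\<And>n m N. real n \<le> K * real N \<Longrightarrow> real m \<le> K * real N \<Longrightarrow>
     measure_pmf.prob (pair_pmf (boundary_pmf n m (X t1) (Y t1)) (grid_pmf n m (geo lam))) (bad n m N t1)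
       \<le> C1 * exp (- c1 * real N)"
    using typical[OF t12(1)] unfolding bad_def by blast
  obtain C2 c2 where C2: "C2 > 0" "c2 > 0" "\<And>n m N. real n \<le> K * real N \<Longrightarrow> real m \<le> K * real N \<Longrightarrow>
     measure_pmf.prob (pair_pmf (boundary_pmf n m (X t2) (Y t2)) (grid_pmf n m (geo lam))) (bad n m N t2)
       \<le> C2 * exp (- c2 * real N)"
    using typical[OF t12(2)] unfolding bad_def by blast
  define c where "c = min c0 (min c1 c2)"
  have c: "c > 0" using C0 C1 C2 by (simp add: c_def)
  \<comment> \<open>From \<open>N0\<close> on, the rounding terms in \<open>y\<close> fit into half
    of \<delta>N. Below \<open>N0\<close> the summand exp(c \<open>N0\<close>) of \<open>C\<close>
    makes the bound exceed 1.\<close>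
  define N0 where "N0 = y * (1 + \<gamma> / (\<kappa> * t)) / (\<delta> / 2)"
  define C where "C = C0 + C1 + C2 + exp (c * N0)"
  have Cpos: "C > 0" using C0 C1 C2 by (simp add: C_def add_pos_pos)
  have bound: "measure_pmf.prob (grid_pmf N m (geo lam)) {w. \<delta> < \<bar>real (corner_lpp w N m) / real N - \<gamma>\<bar>}
       \<le> C * exp (- c * real N)"
    if N: "0 < N" and m: "0 < m" "m = nat \<lfloor>\<beta> * real N\<rfloor>" for N m :: nat
  proof (cases "N0 \<le> real N")
    case False
    have "measure_pmf.prob (grid_pmf N m (geo lam)) {w. \<delta> < \<bar>real (corner_lpp w N m) / real N - \<gamma>\<bar>} \<le> 1"
      by simp
    also have "1 \<le> exp (c * N0) * exp (- c * real N)"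
      using False c by (simp add: exp_add[symmetric])
    also have "\<dots> \<le> C * exp (- c * real N)"
      using C0 C1 C2 by (intro mult_right_mono) (auto simp: C_def)
    finally show ?thesis .
  next
    case True
    have m': "real m \<le> \<beta> * real N" "\<beta> * real N \<le> real m + 1"
      using m assms(3) by auto
    have NK: "real N \<le> K * real N" "real m \<le> K * real N"
      using m'(1) mult_right_mono[of 1 K "real N"] mult_right_mono[of \<beta> K "real N"] by (auto simp: K_def)
    have N0: "y * (1 + \<gamma> / (\<kappa> * t)) \<le> \<delta> / 2 * real N"
      using True assms(4) unfolding N0_def by (simp add: divide_le_eq mult.commute)
    let ?W = "grid_pmf N m (geo lam)"
    let ?B = "\<lambda>\<tau>. boundary_pmf N m (X \<tau>) (Y \<tau>)"
    \<comment> \<open>A coupling of the three stationary models over the same bulk weights. The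
      boundaries are drawn independently for convenience; only the law of each model on its own
      enters the estimates.\<close>
    define Q where "Q = pair_pmf (?B t) (pair_pmf (?B t1) (pair_pmf (?B t2) ?W))"
    let ?E = "{w. \<delta> < \<bar>real (corner_lpp w N m) / real N - \<gamma>\<bar>}"
    let ?p0 = "\<lambda>(b0, b1, b2, w). (b0, w)" and ?p1 = "\<lambda>(b0, b1, b2, w). (b1, w)"
      and ?p2 = "\<lambda>(b0, b1, b2, w). (b2, w)"
    have maps: "map_pmf (\<lambda>(b0, b1, b2, w). w) Q = ?W" "map_pmf ?p0 Q = pair_pmf (?B t) ?W"
      "map_pmf ?p1 Q = pair_pmf (?B t1) ?W" "map_pmf ?p2 Q = pair_pmf (?B t2) ?W"
      unfolding Q_def
      by (simp_all add: pair_pmf_def map_bind_pmf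
          bind_assoc_pmf bind_return_pmf bind_return_pmf')
    have "measure_pmf.prob ?W ?E = measure_pmf.prob Q ((\<lambda>(b0, b1, b2, w). w) -` ?E)"
      using arg_cong[OF maps(1), of "\<lambda>p. measure_pmf.prob p ?E"] by (simp only: measure_map_pmf)
    also have "\<dots> \<le> measure_pmf.prob Q ((?p0 -` bad N m N t \<union> ?p1 -` bad N m N t1) \<union> ?p2 -` bad N m N t2)"
    proof (intro measure_pmf.finite_measure_mono subsetI, rule ccontr)
      fix z assume z: "z \<in> (\<lambda>(b0, b1, b2, w). w) -` ?E"
        and nz: "z \<notin> (?p0 -` bad N m N t \<union> ?p1 -` bad N m N t1) \<union> ?p2 -` bad N m N t2"
      obtain U V U1 V1 U2 V2 w where zz: "z = ((U, V), (U1, V1), (U2, V2), w)"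
        by (metis prod.collapse)
      have "\<bar>real (corner_lpp w N m) - \<gamma> * real N\<bar> \<le> \<delta> * real N"
      proof (rule typical_imp_corner_lpp_close[OF pos(1-3) assms(3) \<kappa> assms(4) tt x_def y_def \<gamma> \<kappa>\<delta> N0 N m(1) m'])
        show "typical_boundary_lpp N m x y (t * \<kappa>\<^sup>2 * real N) U V w"
          using nz by (simp add: zz bad_def X_def Y_def x_def y_def \<eta>_def)
        show "typical_boundary_lpp N m (r + t * (1 + \<kappa>)) (r + q / (t * (1 + \<kappa>))) (t * \<kappa>\<^sup>2 * real N) U1 V1 w"
          using nz by (simp add: zz bad_def X_def Y_def t1_def \<eta>_def)
        show "typical_boundary_lpp N m (r + t / (1 + \<kappa>)) (r + q / (t / (1 + \<kappa>))) (t * \<kappa>\<^sup>2 * real N) U2 V2 w"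
          using nz by (simp add: zz bad_def X_def Y_def t2_def \<eta>_def)
      qed
      then have "\<bar>real (corner_lpp w N m) - \<gamma> * real N\<bar> / real N \<le> \<delta>"
        using N by (simp add: pos_divide_le_eq)
      moreover have "real (corner_lpp w N m) / real N - \<gamma> = (real (corner_lpp w N m) - \<gamma> * real N) / real N"
        using N by (simp add: diff_divide_distrib)
      then have "\<bar>real (corner_lpp w N m) / real N - \<gamma>\<bar> = \<bar>real (corner_lpp w N m) - \<gamma> * real N\<bar> / real N"
        by simp
      ultimately show False using z by (simp add: zz)
    qed simp
    also have "\<dots> \<le> measure_pmf.prob Q (?p0 -` bad N m N t \<union> ?p1 -` bad N m N t1) + measure_pmf.prob Q (?p2 -` bad N m N t2)"
      by (intro measure_Un_le) auto
    also have "measure_pmf.prob Q (?p0 -` bad N m N t \<union> ?p1 -` bad N m N t1) \<le>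
        measure_pmf.prob Q (?p0 -` bad N m N t) + measure_pmf.prob Q (?p1 -` bad N m N t1)"
      by (intro measure_Un_le) auto
    also have "measure_pmf.prob Q (?p0 -` bad N m N t) \<le> C0 * exp (- c0 * real N)"
      using C0(3)[OF NK] by (simp only: maps(2)[symmetric] measure_map_pmf)
    also have "measure_pmf.prob Q (?p1 -` bad N m N t1) \<le> C1 * exp (- c1 * real N)"
      using C1(3)[OF NK] by (simp only: maps(3)[symmetric] measure_map_pmf)
    also have "measure_pmf.prob Q (?p2 -` bad N m N t2) \<le> C2 * exp (- c2 * real N)"
      using C2(3)[OF NK] by (simp only: maps(4)[symmetric] measure_map_pmf)
    also have "C0 * exp (- c0 * real N) + C1 * exp (- c1 * real N) + C2 * exp (- c2 * real N) \<le>
        C0 * exp (- c * real N) + C1 * exp (- c * real N) + C2 * exp (- c * real N)"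
      using C0 C1 C2 by (intro add_mono mult_left_mono) (auto simp: c_def intro!: mult_right_mono)
    also have "\<dots> = (C0 + C1 + C2) * exp (- c * real N)" by (simp add: algebra_simps)
    also have "\<dots> \<le> C * exp (- c * real N)" by (intro mult_right_mono) (auto simp: C_def)
    finally show ?thesis by simp
  qed
  show ?thesis using bound Cpos c by blast
qed

section \<open>Transfer to the given probability space\<close>

text \<open>The random grid takes values in a countable set, so comparing the probabilities of
  single configurations suffices, and \<open>P\<close> may be any predicate: its event is a
  countable union. Zero outside the rectangle matches the default of \<open>Pi_pmf\<close>; the
  indices switch from (column, row) to row first and start at 0.\<close>

lemma (in prob_space) iid_geo_grid_law:
  fixes \<xi> :: "nat \<times> nat \<Rightarrow> 'a \<Rightarrow> nat"
  assumes lam: "0 < lam" "lam < 1" and nm: "0 < n" "0 < m"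
    and ind: "indep_vars (\<lambda>_. count_space UNIV) \<xi> ({1..} \<times> {1..})"
    and law: "\<And>y k. y \<in> {1..} \<times> {1..} \<Longrightarrow> prob {\<omega> \<in> space M. \<xi> y \<omega> = k} = (1 - lam) * lam ^ k"
  defines "F \<equiv> \<lambda>\<omega> j i. if j < m \<and> i < n then \<xi> (Suc i, Suc j) \<omega> else 0"
  shows "{\<omega> \<in> space M. P (F \<omega>)} \<in> events"
    and "prob {\<omega> \<in> space M. P (F \<omega>)} = measure_pmf.prob (grid_pmf n m (geo lam)) {w. P w}"
proof -
  let ?W = "grid_pmf n m (geo lam)"
  let ?h = "\<lambda>(j, i). (Suc i, Suc j)"
  define J where "J = ?h ` ({..<m} \<times> {..<n})"
  have J: "finite J" "J \<noteq> {}" "J \<subseteq> {1..} \<times> {1..}" using nm by (auto simp: J_def)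
  have rv: "\<xi> y \<in> measurable M (count_space UNIV)" if "y \<in> {1..} \<times> {1..}" for y
    using ind that by (auto simp: indep_vars_def2)
  have pmfW: "pmf ?W w = (\<Prod>j<m. \<Prod>i<n. (1 - lam) * lam ^ w j i)"
    if "\<forall>j i. \<not> (j < m \<and> i < n) \<longrightarrow> w j i = 0" for w
  proof -
    have "pmf ?W w = (\<Prod>j<m. pmf (iid_pmf n (geo lam)) (w j))"
      using that by (subst pmf_Pi') (auto simp: fun_eq_iff)
    also have "\<dots> = (\<Prod>j<m. \<Prod>i<n. (1 - lam) * lam ^ w j i)"
      using that lam by (intro prod.cong refl) (subst pmf_Pi', auto simp: mult.commute)
    finally show ?thesis .
  qed
  have supp: "F \<omega> \<in> set_pmf ?W" for \<omega>
  proof -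
    have "pmf ?W (F \<omega>) > 0"
      using lam by (subst pmfW) (auto simp: F_def intro!: prod_pos)
    then show ?thesis by (simp add: set_pmf_iff)
  qed
  have single: "{\<omega> \<in> space M. F \<omega> = w} \<in> events \<and> emeasure M {\<omega> \<in> space M. F \<omega> = w} = ennreal (pmf ?W w)"
    if w: "w \<in> set_pmf ?W" for w
  proof -
    have w0: "\<forall>j i. \<not> (j < m \<and> i < n) \<longrightarrow> w j i = 0"
    proof -
      have "w j = (\<lambda>_. 0)" if "\<not> j < m" for j
        using w that set_Pi_pmf_subset'[of "{..<m}" "\<lambda>_. 0" "\<lambda>_. iid_pmf n (geo lam)"]
        by (auto simp: PiE_dflt_def)
      moreover have "w j \<in> set_pmf (iid_pmf n (geo lam))" if "j < m" for j
        using w that set_Pi_pmf_subset'[of "{..<m}" "\<lambda>_. 0" "\<lambda>_. iid_pmf n (geo lam)"]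
        by (auto simp: PiE_dflt_def)
      then have "w j i = 0" if "j < m" "\<not> i < n" for i j
        using that set_Pi_pmf_subset[of "{..<n}" 0 "\<lambda>_. geo lam"] by fastforce
      ultimately show ?thesis by metis
    qed
    let ?A = "\<lambda>y. \<xi> y -` {w (snd y - 1) (fst y - 1)} \<inter> space M"
    have eq: "{\<omega> \<in> space M. F \<omega> = w} = (\<Inter>y\<in>J. ?A y)"
    proof (intro equalityI subsetI)
      fix \<omega> assume "\<omega> \<in> {\<omega> \<in> space M. F \<omega> = w}"
      then have "\<omega> \<in> space M" "F \<omega> = w" by auto
      then show "\<omega> \<in> (\<Inter>y\<in>J. ?A y)" by (auto simp: J_def F_def)
    next
      fix \<omega> assume *: "\<omega> \<in> (\<Inter>y\<in>J. ?A y)"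
      have "F \<omega> j i = w j i" for j i
      proof (cases "j < m \<and> i < n")
        case True
        then have "(Suc i, Suc j) \<in> J" by (force simp: J_def)
        with * have "\<omega> \<in> ?A (Suc i, Suc j)" by blast
        then show ?thesis using True by (simp add: F_def)
      next
        case False
        then show ?thesis using w0 by (auto simp: F_def)
      qed
      moreover have "\<omega> \<in> space M" using * J(2) by blast
      ultimately show "\<omega> \<in> {\<omega> \<in> space M. F \<omega> = w}" by (auto simp: fun_eq_iff)
    qed
    have "(\<Inter>y\<in>J. ?A y) \<in> events"
    proof (intro sets.finite_INT J)
      fix y assume "y \<in> J"
      then show "?A y \<in> events" using measurable_sets[OF rv, of y] J(3) by auto
    qed
    moreover have "prob (\<Inter>y\<in>J. ?A y) = (\<Prod>y\<in>J. prob (?A y))"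
      by (rule indep_varsD[OF ind J(2,1,3)]) simp
    moreover have "(\<Prod>y\<in>J. prob (?A y)) = (\<Prod>y\<in>J. (1 - lam) * lam ^ w (snd y - 1) (fst y - 1))"
    proof (intro prod.cong refl)
      fix y assume "y \<in> J"
      have "?A y = {\<omega> \<in> space M. \<xi> y \<omega> = w (snd y - 1) (fst y - 1)}" by auto
      then show "prob (?A y) = (1 - lam) * lam ^ w (snd y - 1) (fst y - 1)"
        using law \<open>y \<in> J\<close> J(3) by (metis subsetD)
    qed
    moreover have "\<dots> = (\<Prod>(j, i)\<in>{..<m} \<times> {..<n}. (1 - lam) * lam ^ w j i)"
      unfolding J_def by (subst prod.reindex) (auto simp: inj_on_def case_prod_unfold)
    moreover have "\<dots> = pmf ?W w"
      by (simp only: pmfW[OF w0] prod.cartesian_product)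
    ultimately show ?thesis unfolding eq by (simp add: emeasure_eq_measure)
  qed
  \<comment> \<open>Intersecting with the support makes the index set of the union
    countable.\<close>
  let ?S = "{w. P w} \<inter> set_pmf ?W"
  have U: "{\<omega> \<in> space M. P (F \<omega>)} = (\<Union>w\<in>?S. {\<omega> \<in> space M. F \<omega> = w})"
    using supp by auto
  show "{\<omega> \<in> space M. P (F \<omega>)} \<in> events"
    unfolding U using single by (intro sets.countable_UN') (auto intro: countable_subset[OF Int_lower2])
  have "emeasure M {\<omega> \<in> space M. P (F \<omega>)} = (\<integral>\<^sup>+ w. emeasure M {\<omega> \<in> space M. F \<omega> = w} \<partial>count_space ?S)"
    unfolding U using single
    by (intro emeasure_UN_countable) (auto simp: disjoint_family_on_def intro: countable_subset[OF Int_lower2])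
  also have "\<dots> = (\<integral>\<^sup>+ w. ennreal (pmf ?W w) \<partial>count_space ?S)"
    using single by (intro nn_integral_cong) auto
  also have "\<dots> = emeasure ?W ?S" by (rule nn_integral_pmf)
  also have "\<dots> = emeasure ?W {w. P w}" by (rule emeasure_Int_set_pmf)
  finally show "prob {\<omega> \<in> space M. P (F \<omega>)} = measure_pmf.prob ?W {w. P w}"
    by (simp add: measure_def)
qed

theorem mainTheorem12:
  fixes M :: "'a measure" and \<xi> :: "nat \<times> nat \<Rightarrow> 'a \<Rightarrow> nat"
    and lam \<beta> :: real
  assumes "prob_space M"
    and "0 < lam" and "lam < 1" and "0 < \<beta>"
    and "prob_space.indep_vars M (\<lambda>_. count_space UNIV) \<xi> ({1..} \<times> {1..})"
    and "\<And>y k. y \<in> {1..} \<times> {1..} \<Longrightarrow>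
           measure M {\<omega> \<in> space M. \<xi> y \<omega> = k} = (1 - lam) * lam ^ k"
  shows "(AE \<omega> in M. (\<lambda>N. real (lpp \<xi> N (nat \<lfloor>\<beta> * real N\<rfloor>) \<omega>) / real N)
             \<longlonglongrightarrow> (1 + sqrt (\<beta> * lam))\<^sup>2 / (1 - lam) - 1)
       \<and> (\<forall>\<delta>>0. \<exists>C>0. \<exists>c>0. \<forall>N::nat. N \<ge> 1 \<longrightarrow> nat \<lfloor>\<beta> * real N\<rfloor> \<ge> 1 \<longrightarrow>
            measure M {\<omega> \<in> space M.
              \<bar>real (lpp \<xi> N (nat \<lfloor>\<beta> * real N\<rfloor>) \<omega>) / real N
                - ((1 + sqrt (\<beta> * lam))\<^sup>2 / (1 - lam) - 1)\<bar> > \<delta>}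
            \<le> C * exp (- c * real N))"
proof -
  interpret prob_space M by fact
  define \<gamma> where "\<gamma> = (1 + sqrt (\<beta> * lam))\<^sup>2 / (1 - lam) - 1"
  define m where "m N = nat \<lfloor>\<beta> * real N\<rfloor>" for N :: nat
  define dev where "dev \<delta> N = {\<omega> \<in> space M. \<delta> < \<bar>real (lpp \<xi> N (m N) \<omega>) / real N - \<gamma>\<bar>}" for \<delta> N
  have transfer: "dev \<delta> N \<in> events"
      "prob (dev \<delta> N) = measure_pmf.prob (grid_pmf N (m N) (geo lam))
         {w. \<delta> < \<bar>real (corner_lpp w N (m N)) / real N - \<gamma>\<bar>}"
    if "0 < N" "0 < m N" for \<delta> N
  proof -
    have "dev \<delta> N = {\<omega> \<in> space M. (\<lambda>w. \<delta> < \<bar>real (corner_lpp w N (m N)) / real N - \<gamma>\<bar>)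
        (\<lambda>j i. if j < m N \<and> i < N then \<xi> (Suc i, Suc j) \<omega> else 0)}"
    proof -
      have "lpp \<xi> N (m N) \<omega> = corner_lpp (\<lambda>j i. if j < m N \<and> i < N then \<xi> (Suc i, Suc j) \<omega> else 0) N (m N)" for \<omega>
        unfolding lpp_eq_corner_lpp[OF that] by (rule boundary_lpp_cong) auto
      then show ?thesis by (simp add: dev_def)
    qed
    then show "dev \<delta> N \<in> events"
      "prob (dev \<delta> N) = measure_pmf.prob (grid_pmf N (m N) (geo lam))
         {w. \<delta> < \<bar>real (corner_lpp w N (m N)) / real N - \<gamma>\<bar>}"
      using iid_geo_grid_law[OF assms(2,3) that assms(5,6)] by simp_all
  qed
  have conc: "\<exists>C>0. \<exists>c>0. \<forall>N. 0 < N \<longrightarrow> 0 < m N \<longrightarrow> prob (dev \<delta> N) \<le> C * exp (- c * real N)"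
    if \<delta>: "\<delta> > 0" for \<delta>
  proof -
    obtain C c where "C > 0" "c > 0" "\<And>N. 0 < N \<Longrightarrow> 0 < m N \<Longrightarrow>
        measure_pmf.prob (grid_pmf N (m N) (geo lam)) {w. \<delta> < \<bar>real (corner_lpp w N (m N)) / real N - \<gamma>\<bar>}
          \<le> C * exp (- c * real N)"
      using corner_lpp_concentration[OF assms(2-4) \<delta>] unfolding \<gamma>_def m_def by blast
    then show ?thesis using transfer(2) by metis
  qed
  \<comment> \<open>If the floor is 0 there are no paths and \<open>lpp\<close> is the
    \<open>Max\<close> of the empty set; this concerns only finitely many N.\<close>
  have ev_m: "eventually (\<lambda>N. 0 < N \<and> 0 < m N) sequentially"
  proof (rule eventually_sequentiallyI)
    fix N assume "nat \<lceil>1 / \<beta>\<rceil> + 1 \<le> N"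
    then have "1 / \<beta> \<le> real N" "0 < N" by linarith+
    then have "1 \<le> \<beta> * real N" using assms(4) by (simp add: divide_le_eq mult.commute)
    then show "0 < N \<and> 0 < m N" using \<open>0 < N\<close> by (simp add: m_def)
  qed
  have AE_dev: "AE \<omega> in M. eventually (\<lambda>N. \<bar>real (lpp \<xi> N (m N) \<omega>) / real N - \<gamma>\<bar> \<le> \<delta>) sequentially"
    if \<delta>: "\<delta> > 0" for \<delta>
  proof -
    obtain C c where C: "C > 0" "c > 0" "\<And>N. 0 < N \<Longrightarrow> 0 < m N \<Longrightarrow> prob (dev \<delta> N) \<le> C * exp (- c * real N)"
      using conc[OF \<delta>] by blast
    \<comment> \<open>The finitely many N without a probability bound get the empty event, which
      changes neither summability nor the eventual behaviour.\<close>
    define A where "A N = (if 0 < N \<and> 0 < m N then dev \<delta> N else {})" for N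
    have "summable (\<lambda>N. prob (A N))"
    proof (rule summable_comparison_test')
      show "summable (\<lambda>N. C * exp (- c) ^ N)"
        using C by (intro summable_mult summable_geometric) auto
      show "norm (prob (A N)) \<le> C * exp (- c) ^ N" if "N \<ge> 0" for N
        using C by (auto simp: A_def exp_of_nat_mult[symmetric] mult.commute)
    qed
    then have "AE \<omega> in M. eventually (\<lambda>N. \<omega> \<in> space M - A N) sequentially"
      using transfer(1) by (intro borel_cantelli_AE1) (auto simp: A_def less_top[symmetric])
    then show ?thesis
    proof eventually_elim
      case (elim \<omega>)
      with ev_m show ?case
        by eventually_elim (auto simp: A_def dev_def)
    qed
  qed
  \<comment> \<open>Only countably many tolerances, so that the exceptional null sets unite to a
    null set.\<close>
  have "AE \<omega> in M. \<forall>k::nat. eventually (\<lambda>N. \<bar>real (lpp \<xi> N (m N) \<omega>) / real N - \<gamma>\<bar> \<le> 1 / real (Suc k)) sequentially"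
    unfolding AE_all_countable by (intro allI AE_dev) simp
  then have "AE \<omega> in M. (\<lambda>N. real (lpp \<xi> N (m N) \<omega>) / real N) \<longlonglongrightarrow> \<gamma>"
  proof eventually_elim
    case (elim \<omega>)
    show ?case
    proof (rule tendstoI)
      fix e :: real assume "e > 0"
      then obtain k where "1 / real (Suc k) < e" using nat_approx_posE by blast
      with elim[rule_format, of k]
      show "eventually (\<lambda>N. dist (real (lpp \<xi> N (m N) \<omega>) / real N) \<gamma> < e) sequentially"
        by (auto simp: dist_real_def elim!: eventually_mono)
    qed
  qed
  moreover have "\<forall>\<delta>>0. \<exists>C>0. \<exists>c>0. \<forall>N::nat. N \<ge> 1 \<longrightarrow> m N \<ge> 1 \<longrightarrow> prob (dev \<delta> N) \<le> C * exp (- c * real N)"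
    using conc by (simp add: Suc_le_eq)
  ultimately show ?thesis
    unfolding dev_def m_def \<gamma>_def by blast
qed

end
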